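(* Let $p<q$ be positive integers with $p+q$ odd and $\gcd(p,q)=1$, and let $L$ be the skew free $(p,q)$-leaper. Let $\kappa$ be the depth of $L$ and let its tails be the $(p_i,q_i)$-leapers $L_i$ for $0\le i\le\kappa$. For each $i$ with $0\le i\le \kappa$, let $A^{\mathcal R}_i$ be a board of size $(p+q-p_i+1)\times(p+q+q_i-[q_i \bmod 2])$. Then, for every board $A$, the complete leaper graph of $L$ on $A$ is directionally rigid if and only if $A^{\mathcal R}_i\sqsubseteq A$ for some $i$ with $0\le i\le\kappa$.
   Context: A cell is an element of $\mathbb Z^2$. A board of size $m\times n$ ($m$ rows, $n$ columns, $m,n\ge 1$) is a product $I_X\times I_Y$ of integer intervals with $|I_X|=n$, $|I_Y|=m$. For boards $A',A''$ of sizes $m'\times n'$ and $m''\times n''$, write $A'\sqsubseteq A''$ if either $m'\le m''$ and $n'\le n''$, or $n'\le m''$ and $m'\le n''$. For an $(r,s)$-leaper, two cells $(x',y')$, $(x'',y'')$ are adjacent when $\{|x'-x''|,|y'-y''|\}=\{r,s\}$; an edge of the leaper is a pair of adjacent cells. A leaper is skew if $r,s$ are distinct positive integers, and free if its graph on all of $\mathbb Z^2$ is connected (equivalently $r+s$ is odd and $\gcd(r,s)=1$). A leaper graph of a leaper is a graph whose vertices are cells and all of whose edges are edges of that leaper (not necessarily all of them). The complete leaper graph on a board $A$ has as vertices all cells of $A$ and as edges all edges of the leaper between cells of $A$. Directions: a move is an oriented edge. For a skew $(r,s)$-leaper with $r<s$, the direction of a move $a\to b$ is one of eight: east-northeast if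 $b-a=(s,r)$, north-northeast if $(r,s)$, north-northwest if $(-r,s)$, west-northwest if $(-s,r)$, west-southwest if $(-s,-r)$, south-southwest if $(-r,-s)$, south-southeast if $(r,-s)$, east-southeast if $(s,-r)$. A leaper graph $G'$ of a skew leaper $L'$ and a leaper graph $G''$ of a skew leaper $L''$ are direction-isomorphic if there is a graph isomorphism $\varphi:G'\to G''$ such that for each edge $ab$ of $G'$ the move $a\to b$ of $L'$ and the move $\varphi(a)\to\varphi(b)$ of $L''$ have the same direction. Two skew leapers are proportional if their parameters (smaller to larger) are in the same ratio. A finite leaper graph of $L$ is directionally flexible if it is direction-isomorphic to some leaper graph of a skew leaper not proportional to $L$; otherwise it is directionally rigid. Even continued fraction: $q/p$ has a unique expansion $c_\kappa+\varepsilon_{\kappa-1}/(c_{\kappa-1}+\varepsilon_{\kappa-2}/(\cdots+\varepsilon_1/c_1))$ with all $c_i$ even positive integers and all $\varepsilon_i\in\{-1,1\}$, written $[c_\kappa,\varepsilon_{\kappa-1},c_{\kappa-1},\varepsilon_{\kappa-2},\ldots,c_1]$; $\kappa$ is the depth of $L$. For $1\le i\le\kappa$ the $i$-th tail $L_i$ is the skew free $(p_i,q_i)$-leaper with $p_i<q_i$, $\gcd(p_i,q_i)=1$ and $q_i/p_i=[c_i,\varepsilon_{i-1},c_{i-1},\ldots,c_1]$. Also $p_0=0$, $q_0=1$, and $L_0$ is the $(0,1)$-leaper. Here $[q_i\bmod 2]\in\{0,1\}$ is the remainder of $q_i$ modulo $2$. *)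

theory Defs
  imports Complex_Main
begin

type_synonym cell = "int \<times> int"

text \<open>Rows are counted by the second coordinate and columns by the first one.\<close>

definition board_of_size :: "nat \<Rightarrow> nat \<Rightarrow> cell set \<Rightarrow> bool" where
  "board_of_size m n A \<longleftrightarrow> 1 \<le> m \<and> 1 \<le> n \<and>
     (\<exists>x y. A = {x..<x + int n} \<times> {y..<y + int m})"

definition board :: "cell set \<Rightarrow> bool" where
  "board A \<longleftrightarrow> (\<exists>m n. board_of_size m n A)"

definition board_le :: "cell set \<Rightarrow> cell set \<Rightarrow> bool"  (infix \<open>\<sqsubseteq>\<close> 50) where
  "A' \<sqsubseteq> A'' \<longleftrightarrow> (\<exists>m' n' m'' n''. board_of_size m' n' A' \<and> board_of_size m'' n'' A'' \<and>
     (m' \<le> m'' \<and> n' \<le> n'' \<or> n' \<le> m'' \<and> m' \<le> n''))"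


text \<open>An \<open>(r, s)\<close>-leaper is represented by the pair of its parameters. The order of the
  parameters is immaterial: the notions below do not change when they are swapped.\<close>

type_synonym leaper = "nat \<times> nat"

fun adjacent :: "leaper \<Rightarrow> cell \<Rightarrow> cell \<Rightarrow> bool" where
  "adjacent (r, s) (x', y') (x'', y'') \<longleftrightarrow> {\<bar>x' - x''\<bar>, \<bar>y' - y''\<bar>} = {int r, int s}"

fun skew :: "leaper \<Rightarrow> bool" where
  "skew (r, s) \<longleftrightarrow> 0 < r \<and> 0 < s \<and> r \<noteq> s"

fun proportional :: "leaper \<Rightarrow> leaper \<Rightarrow> bool" where
  "proportional (r', s') (r'', s'') \<longleftrightarrow>
     real (min r' s') / real (max r' s') = real (min r'' s'') / real (max r'' s'')"


text \<open>A graph is a set of vertices together with a set of edges, each edge being an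
  unordered pair of vertices.\<close>

type_synonym cell_graph = "cell set \<times> cell set set"

fun leaper_graph :: "leaper \<Rightarrow> cell_graph \<Rightarrow> bool" where
  "leaper_graph L (V, E) \<longleftrightarrow> E \<subseteq> {{a, b} | a b. a \<in> V \<and> b \<in> V \<and> adjacent L a b}"

definition complete_leaper_graph :: "leaper \<Rightarrow> cell set \<Rightarrow> cell_graph" where
  "complete_leaper_graph L A = (A, {{a, b} | a b. a \<in> A \<and> b \<in> A \<and> adjacent L a b})"

fun graph_iso :: "(cell \<Rightarrow> cell) \<Rightarrow> cell_graph \<Rightarrow> cell_graph \<Rightarrow> bool" where
  "graph_iso \<phi> (V', E') (V'', E'') \<longleftrightarrow> bij_betw \<phi> V' V'' \<and>
     (\<forall>a\<in>V'. \<forall>b\<in>V'. {a, b} \<in> E' \<longleftrightarrow> {\<phi> a, \<phi> b} \<in> E'')"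


datatype direction = ENE | NNE | NNW | WNW | WSW | SSW | SSE | ESE

primrec direction_offset :: "int \<Rightarrow> int \<Rightarrow> direction \<Rightarrow> int \<times> int" where
  "direction_offset r s ENE = (s, r)"
| "direction_offset r s NNE = (r, s)"
| "direction_offset r s NNW = (- r, s)"
| "direction_offset r s WNW = (- s, r)"
| "direction_offset r s WSW = (- s, - r)"
| "direction_offset r s SSW = (- r, - s)"
| "direction_offset r s SSE = (r, - s)"
| "direction_offset r s ESE = (s, - r)"

fun move_direction :: "leaper \<Rightarrow> cell \<Rightarrow> cell \<Rightarrow> direction \<Rightarrow> bool" where
  "move_direction (r, s) a b d \<longleftrightarrow>
     (fst b - fst a, snd b - snd a) = direction_offset (int (min r s)) (int (max r s)) d"

definition direction_isomorphic ::
    "leaper \<Rightarrow> cell_graph \<Rightarrow> leaper \<Rightarrow> cell_graph \<Rightarrow> bool" where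
  "direction_isomorphic L' G' L'' G'' \<longleftrightarrow> (\<exists>\<phi>. graph_iso \<phi> G' G'' \<and>
     (\<forall>a b. {a, b} \<in> snd G' \<longrightarrow>
        (\<exists>d. move_direction L' a b d \<and> move_direction L'' (\<phi> a) (\<phi> b) d)))"

definition directionally_flexible :: "leaper \<Rightarrow> cell_graph \<Rightarrow> bool" where
  "directionally_flexible L G \<longleftrightarrow> leaper_graph L G \<and> finite (fst G) \<and>
     (\<exists>L'' G''. skew L'' \<and> \<not> proportional L'' L \<and> leaper_graph L'' G'' \<and>
        direction_isomorphic L G L'' G'')"

definition directionally_rigid :: "leaper \<Rightarrow> cell_graph \<Rightarrow> bool" where
  "directionally_rigid L G \<longleftrightarrow> leaper_graph L G \<and> finite (fst G) \<and>
     \<not> directionally_flexible L G"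


text \<open>\<open>ecf c \<epsilon> i\<close> is the value of
  \<open>c i + \<epsilon> (i-1) / (c (i-1) + \<epsilon> (i-2) / (\<dots> + \<epsilon> 1 / c 1))\<close>; the value at \<open>i = 0\<close> is irrelevant.\<close>

fun ecf :: "(nat \<Rightarrow> nat) \<Rightarrow> (nat \<Rightarrow> int) \<Rightarrow> nat \<Rightarrow> real" where
  "ecf c \<epsilon> 0 = 0"
| "ecf c \<epsilon> (Suc 0) = real (c 1)"
| "ecf c \<epsilon> (Suc (Suc i)) = real (c (Suc (Suc i))) + real_of_int (\<epsilon> (Suc i)) / ecf c \<epsilon> (Suc i)"

definition even_cf_expansion ::
    "nat \<Rightarrow> (nat \<Rightarrow> nat) \<Rightarrow> (nat \<Rightarrow> int) \<Rightarrow> real \<Rightarrow> bool" where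
  "even_cf_expansion \<kappa> c \<epsilon> x \<longleftrightarrow> 1 \<le> \<kappa> \<and>
     (\<forall>i\<in>{1..\<kappa>}. even (c i) \<and> 0 < c i) \<and>
     (\<forall>i\<in>{1..<\<kappa>}. \<epsilon> i \<in> {- 1, 1}) \<and>
     x = ecf c \<epsilon> \<kappa>"

text \<open>\<open>leaper_tails p q \<kappa> P Q\<close>: the \<open>(p, q)\<close>-leaper has depth \<open>\<kappa>\<close> and, for \<open>i \<le> \<kappa>\<close>, its
  \<open>i\<close>-th tail is the \<open>(P i, Q i)\<close>-leaper. The lemmas below show that these
  data exist and are uniquely determined by \<open>p\<close> and \<open>q\<close>.\<close>

definition leaper_tails ::
    "nat \<Rightarrow> nat \<Rightarrow> nat \<Rightarrow> (nat \<Rightarrow> nat) \<Rightarrow> (nat \<Rightarrow> nat) \<Rightarrow> bool" where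
  "leaper_tails p q \<kappa> P Q \<longleftrightarrow> (\<exists>c \<epsilon>. even_cf_expansion \<kappa> c \<epsilon> (real q / real p) \<and>
     P 0 = 0 \<and> Q 0 = 1 \<and>
     (\<forall>i\<in>{1..\<kappa>}. 0 < P i \<and> P i < Q i \<and> coprime (P i) (Q i) \<and>
        real (Q i) / real (P i) = ecf c \<epsilon> i))"

lemma ecf_cong:
  assumes "\<And>j. 1 \<le> j \<Longrightarrow> j \<le> i \<Longrightarrow> c j = c' j"
    and "\<And>j. 1 \<le> j \<Longrightarrow> j < i \<Longrightarrow> \<epsilon> j = \<epsilon>' j"
  shows "ecf c \<epsilon> i = ecf c' \<epsilon>' i"
  using assms by (induction c \<epsilon> i rule: ecf.induct) auto

lemma even_cf_expansion_pred:
  assumes "even_cf_expansion (Suc (Suc k)) c \<epsilon> x"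
  shows "even_cf_expansion (Suc k) c \<epsilon> (ecf c \<epsilon> (Suc k))"
  using assms by (auto simp: even_cf_expansion_def)

lemma even_cf_expansion_gt_1:
  assumes "even_cf_expansion k c \<epsilon> x"
  shows "x > 1"
  using assms
proof (induction k arbitrary: x)
  case 0
  then show ?case by (simp add: even_cf_expansion_def)
next
  case (Suc k)
  have ge2: "real (c (Suc k)) \<ge> 2"
  proof -
    have "even (c (Suc k))" "0 < c (Suc k)"
      using Suc.prems by (auto simp: even_cf_expansion_def)
    then have "c (Suc k) \<ge> 2" by presburger
    then show ?thesis by simp
  qed
  show ?case
  proof (cases k)
    case 0
    then show ?thesis using Suc.prems ge2 by (simp add: even_cf_expansion_def)
  next
    case (Suc j)
    have gt: "ecf c \<epsilon> k > 1"
      using Suc.IH even_cf_expansion_pred Suc.prems Suc by blast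
    have e: "\<epsilon> k \<in> {- 1, 1}" using Suc.prems Suc by (auto simp: even_cf_expansion_def)
    have "real_of_int (\<epsilon> k) / ecf c \<epsilon> k > - 1" using gt e by (auto simp: field_simps)
    moreover have "x = real (c (Suc k)) + real_of_int (\<epsilon> k) / ecf c \<epsilon> k"
      using Suc.prems Suc by (simp add: even_cf_expansion_def)
    ultimately show ?thesis using ge2 by linarith
  qed
qed

lemma even_dist_lt_1_unique:
  fixes a b :: nat
  assumes "even a" "even b" "\<bar>x - real a\<bar> < 1" "\<bar>x - real b\<bar> < 1"
  shows "a = b"
proof -
  have "\<bar>real a - real b\<bar> < 2" using assms(3,4) by linarith
  then have "\<bar>int a - int b\<bar> < 2" by linarith
  then show ?thesis using assms(1,2) by presburger
qed

lemma even_cf_expansion_unique: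
  assumes "even_cf_expansion \<kappa> c \<epsilon> x" "even_cf_expansion \<kappa>' c' \<epsilon>' x"
  shows "\<kappa> = \<kappa>' \<and> (\<forall>i\<in>{1..\<kappa>}. c i = c' i) \<and> (\<forall>i\<in>{1..<\<kappa>}. \<epsilon> i = \<epsilon>' i)"
  using assms
proof (induction \<kappa> arbitrary: \<kappa>' x)
  case 0
  then show ?case by (simp add: even_cf_expansion_def)
next
  case (Suc k)
  obtain k' where k': "\<kappa>' = Suc k'"
    using Suc.prems(2) by (cases \<kappa>') (auto simp: even_cf_expansion_def)
  have step: "(\<exists>d. \<bar>x - real (c (Suc k))\<bar> < 1 \<and> even (c (Suc k)) \<and>
      x = real (c (Suc k)) + d \<and> (k = 0 \<longrightarrow> d = 0) \<and>
      (k \<noteq> 0 \<longrightarrow> (\<epsilon> k = 1 \<or> \<epsilon> k = - 1) \<and> d = real_of_int (\<epsilon> k) / ecf c \<epsilon> k \<and>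
        ecf c \<epsilon> k > 1 \<and> even_cf_expansion k c \<epsilon> (ecf c \<epsilon> k)))"
    if "even_cf_expansion (Suc k) c \<epsilon> x" for k c \<epsilon>
  proof (cases k)
    case 0
    then show ?thesis using that by (auto simp: even_cf_expansion_def)
  next
    case (Suc j)
    have ex: "even_cf_expansion k c \<epsilon> (ecf c \<epsilon> k)"
      using even_cf_expansion_pred that Suc by blast
    then have gt: "ecf c \<epsilon> k > 1" by (rule even_cf_expansion_gt_1)
    have e: "\<epsilon> k = 1 \<or> \<epsilon> k = - 1" using that Suc by (auto simp: even_cf_expansion_def)
    have "\<bar>real_of_int (\<epsilon> k) / ecf c \<epsilon> k\<bar> < 1" using gt e by (auto simp: field_simps)
    moreover have "x = real (c (Suc k)) + real_of_int (\<epsilon> k) / ecf c \<epsilon> k"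
      using that Suc by (simp add: even_cf_expansion_def)
    moreover have "even (c (Suc k))" using that by (auto simp: even_cf_expansion_def)
    ultimately show ?thesis using ex gt e Suc by auto
  qed
  obtain d where d: "\<bar>x - real (c (Suc k))\<bar> < 1" "even (c (Suc k))"
      "x = real (c (Suc k)) + d" "k = 0 \<Longrightarrow> d = 0"
      "k \<noteq> 0 \<Longrightarrow> (\<epsilon> k = 1 \<or> \<epsilon> k = - 1) \<and> d = real_of_int (\<epsilon> k) / ecf c \<epsilon> k \<and>
        ecf c \<epsilon> k > 1 \<and> even_cf_expansion k c \<epsilon> (ecf c \<epsilon> k)"
    using step[OF Suc.prems(1)] by blast
  obtain d' where d': "\<bar>x - real (c' (Suc k'))\<bar> < 1" "even (c' (Suc k'))"
      "x = real (c' (Suc k')) + d'" "k' = 0 \<Longrightarrow> d' = 0"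
      "k' \<noteq> 0 \<Longrightarrow> (\<epsilon>' k' = 1 \<or> \<epsilon>' k' = - 1) \<and> d' = real_of_int (\<epsilon>' k') / ecf c' \<epsilon>' k' \<and>
        ecf c' \<epsilon>' k' > 1 \<and> even_cf_expansion k' c' \<epsilon>' (ecf c' \<epsilon>' k')"
    using step[OF Suc.prems(2)[unfolded k']] by blast
  have c: "c (Suc k) = c' (Suc k')" using even_dist_lt_1_unique d(1,2) d'(1,2) by blast
  have dd: "d = d'" using c d(3) d'(3) by simp
  have nz: "k \<noteq> 0 \<Longrightarrow> d \<noteq> 0" "k' \<noteq> 0 \<Longrightarrow> d' \<noteq> 0" using d(5) d'(5) by auto
  show ?case
  proof (cases "k = 0")
    case True
    then have "k' = 0" using nz dd d(4) by auto
    then show ?thesis using True c k' by auto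
  next
    case False
    then have k'0: "k' \<noteq> 0" using nz dd d'(4) by auto
    note D = d(5)[OF False] and D' = d'(5)[OF k'0]
    have eq: "real_of_int (\<epsilon> k) / ecf c \<epsilon> k = real_of_int (\<epsilon>' k') / ecf c' \<epsilon>' k'"
      using dd D D' by simp
    have cross: "real_of_int (\<epsilon> k) * ecf c' \<epsilon>' k' = real_of_int (\<epsilon>' k') * ecf c \<epsilon> k"
    proof -
      have "ecf c \<epsilon> k \<noteq> 0" "ecf c' \<epsilon>' k' \<noteq> 0" using D D' by auto
      then show ?thesis using eq by (simp add: frac_eq_eq)
    qed
    have gt: "ecf c \<epsilon> k > 1" "ecf c' \<epsilon>' k' > 1" using D D' by blast+
    have signs: "\<epsilon> k = 1 \<or> \<epsilon> k = - 1" "\<epsilon>' k' = 1 \<or> \<epsilon>' k' = - 1" using D D' by blast+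
    have "\<epsilon> k = \<epsilon>' k' \<and> ecf c \<epsilon> k = ecf c' \<epsilon>' k'"
      using signs
    proof (elim disjE)
      assume "\<epsilon> k = 1" "\<epsilon>' k' = 1"
      then show ?thesis using cross by simp
    next
      assume "\<epsilon> k = 1" "\<epsilon>' k' = - 1"
      then have "ecf c' \<epsilon>' k' = - ecf c \<epsilon> k" using cross by simp
      then show ?thesis using gt by linarith
    next
      assume "\<epsilon> k = - 1" "\<epsilon>' k' = 1"
      then have "- ecf c' \<epsilon>' k' = ecf c \<epsilon> k" using cross by simp
      then show ?thesis using gt by linarith
    next
      assume "\<epsilon> k = - 1" "\<epsilon>' k' = - 1"
      then show ?thesis using cross by simp
    qed
    then have e: "\<epsilon> k = \<epsilon>' k'" and v: "ecf c \<epsilon> k = ecf c' \<epsilon>' k'" by blast+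
    have "k = k' \<and> (\<forall>i\<in>{1..k}. c i = c' i) \<and> (\<forall>i\<in>{1..<k}. \<epsilon> i = \<epsilon>' i)"
      using Suc.IH D D' v by metis
    then show ?thesis using k' c e by (auto simp: le_Suc_eq less_Suc_eq)
  qed
qed

lemma leaper_tails_unique:
  assumes "leaper_tails p q \<kappa> P Q" "leaper_tails p q \<kappa>' P' Q'"
  shows "\<kappa> = \<kappa>'" and "i \<le> \<kappa> \<Longrightarrow> P i = P' i \<and> Q i = Q' i"
proof -
  obtain c \<epsilon> where 1: "even_cf_expansion \<kappa> c \<epsilon> (real q / real p)" "P 0 = 0" "Q 0 = 1"
    "\<And>i. i \<in> {1..\<kappa>} \<Longrightarrow> 0 < P i \<and> P i < Q i \<and> coprime (P i) (Q i) \<and>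
        real (Q i) / real (P i) = ecf c \<epsilon> i"
    using assms(1) unfolding leaper_tails_def by blast
  obtain c' \<epsilon>' where 2: "even_cf_expansion \<kappa>' c' \<epsilon>' (real q / real p)" "P' 0 = 0" "Q' 0 = 1"
    "\<And>i. i \<in> {1..\<kappa>'} \<Longrightarrow> 0 < P' i \<and> P' i < Q' i \<and> coprime (P' i) (Q' i) \<and>
        real (Q' i) / real (P' i) = ecf c' \<epsilon>' i"
    using assms(2) unfolding leaper_tails_def by blast
  note u = even_cf_expansion_unique[OF 1(1) 2(1)]
  show k: "\<kappa> = \<kappa>'" using u by blast
  show "P i = P' i \<and> Q i = Q' i" if "i \<le> \<kappa>"
  proof (cases "i = 0")
    case True
    then show ?thesis using 1 2 by simp
  next
    case False
    then have i: "i \<in> {1..\<kappa>}" "i \<in> {1..\<kappa>'}" using that k by auto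
    have "ecf c \<epsilon> i = ecf c' \<epsilon>' i" using u that by (intro ecf_cong) auto
    then have "real (Q i) / real (P i) = real (Q' i) / real (P' i)"
      using 1(4)[OF i(1)] 2(4)[OF i(2)] by simp
    moreover have "real (P i) \<noteq> 0" "real (P' i) \<noteq> 0"
      using 1(4)[OF i(1)] 2(4)[OF i(2)] by auto
    ultimately have "real (Q i) * real (P' i) = real (Q' i) * real (P i)"
      by (simp add: frac_eq_eq)
    then have "Q i * P' i = Q' i * P i" by (metis of_nat_eq_iff of_nat_mult)
    then show ?thesis
      using 1(4)[OF i(1)] 2(4)[OF i(2)] coprime_crossproduct_nat[of "Q i" "P i" "Q' i" "P' i"]
      by (auto simp: coprime_commute mult.commute)
  qed
qed

lemma even_nearest:
  fixes p q :: nat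
  assumes "1 < p" "p < q" "coprime p q"
  shows "\<exists>a (\<sigma>::int) r. even a \<and> 0 < a \<and> \<sigma> \<in> {- 1, 1} \<and> 0 < r \<and> r < p \<and>
    int q = int a * int p + \<sigma> * int r"
proof -
  define m where "m = q div p"
  define t where "t = q mod p"
  have q: "q = m * p + t" by (simp add: m_def t_def)
  have t: "t < p" "t \<noteq> 0"
    using assms by (auto simp: t_def coprime_iff_gcd_eq_1 dvd_eq_mod_eq_0[symmetric])
  have m: "m \<ge> 1" using assms by (simp add: m_def Suc_le_eq div_greater_zero_iff)
  show ?thesis
  proof (cases "even m")
    case True
    then show ?thesis using q t m by (intro exI[of _ m] exI[of _ 1] exI[of _ t]) auto
  next
    case False
    have "int q = int (m + 1) * int p + (- 1) * int (p - t)"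
      using q t by (simp add: algebra_simps of_nat_diff)
    then show ?thesis using False t
      by (intro exI[of _ "m + 1"] exI[of _ "- 1"] exI[of _ "p - t"]) auto
  qed
qed

lemma leaper_tails_exist:
  assumes "0 < p" "p < q" "odd (p + q)" "coprime p q"
  shows "\<exists>\<kappa> P Q. leaper_tails p q \<kappa> P Q"
  using assms
proof (induction p arbitrary: q rule: less_induct)
  case (less p)
  show ?case
  proof (cases "p = 1")
    case True
    have "leaper_tails p q 1 (\<lambda>i. if i = 0 then 0 else 1) (\<lambda>i. if i = 0 then 1 else q)"
      unfolding leaper_tails_def even_cf_expansion_def
      using True less.prems by (intro exI[of _ "\<lambda>_. q"] exI[of _ "\<lambda>_. 1"]) auto
    then show ?thesis by blast
  next
    case False
    then have "1 < p" using less.prems by simp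
    then obtain a r and \<sigma> :: int where a: "even a" "0 < a" "\<sigma> \<in> {- 1, 1}" "0 < r" "r < p"
      "int q = int a * int p + \<sigma> * int r"
      using even_nearest less.prems by metis
    have cop: "coprime r p"
    proof -
      have "coprime (int p) (int q)" using less.prems by simp
      then have "gcd (int p) (\<sigma> * int r + int a * int p) = 1"
        unfolding a(6) by (simp add: coprime_iff_gcd_eq_1 add.commute)
      then have "gcd (int p) (\<sigma> * int r) = 1"
        by (metis add.commute gcd_add_mult)
      then have "coprime (int p) (\<sigma> * int r)" by (simp add: coprime_iff_gcd_eq_1)
      then show ?thesis using a(3) by (auto simp: coprime_commute)
    qed
    have "odd (int p + int q)" using less.prems(3) by (metis even_of_nat of_nat_add)
    then have odd: "odd (r + p)" using a(1,3) unfolding a(6) by auto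
    obtain k P Q where "leaper_tails r p k P Q"
      using less.IH[OF a(5,4,5) odd cop] by blast
    then obtain c \<epsilon> where 1: "even_cf_expansion k c \<epsilon> (real p / real r)" "P 0 = 0" "Q 0 = 1"
      "\<forall>i\<in>{1..k}. 0 < P i \<and> P i < Q i \<and> coprime (P i) (Q i) \<and>
        real (Q i) / real (P i) = ecf c \<epsilon> i"
      unfolding leaper_tails_def by blast
    define c' where "c' = c(Suc k := a)"
    define \<epsilon>' where "\<epsilon>' = \<epsilon>(k := \<sigma>)"
    have k: "1 \<le> k" using 1(1) by (simp add: even_cf_expansion_def)
    have old: "ecf c' \<epsilon>' i = ecf c \<epsilon> i" if "i \<le> k" for i
      using that by (intro ecf_cong) (auto simp: c'_def \<epsilon>'_def)
    have "real q = real a * real p + real_of_int \<sigma> * real r"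
      using arg_cong[OF a(6), of real_of_int] by simp
    then have "real q / real p = real a + real_of_int \<sigma> / (real p / real r)"
      using less.prems a(4) by (simp add: field_simps)
    also have "real p / real r = ecf c' \<epsilon>' k"
      using 1(1) old by (simp add: even_cf_expansion_def)
    also have "real a + real_of_int \<sigma> / ecf c' \<epsilon>' k = ecf c' \<epsilon>' (Suc k)"
      using k by (cases k) (auto simp: c'_def \<epsilon>'_def)
    finally have new: "real q / real p = ecf c' \<epsilon>' (Suc k)" .
    have "even_cf_expansion (Suc k) c' \<epsilon>' (real q / real p)"
      using 1(1) a new by (auto simp: even_cf_expansion_def c'_def \<epsilon>'_def)
    moreover have "0 < (P(Suc k := p)) i \<and> (P(Suc k := p)) i < (Q(Suc k := q)) i \<and>
        coprime ((P(Suc k := p)) i) ((Q(Suc k := q)) i) \<and>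
        real ((Q(Suc k := q)) i) / real ((P(Suc k := p)) i) = ecf c' \<epsilon>' i"
      if "i \<in> {1..Suc k}" for i
      using that 1(4) new less.prems old by (cases "i = Suc k") auto
    ultimately have "leaper_tails p q (Suc k) (P(Suc k := p)) (Q(Suc k := q))"
      unfolding leaper_tails_def using 1(2,3)
      by (intro exI[of _ c'] exI[of _ \<epsilon>']) auto
    then show ?thesis by blast
  qed
qed

end

theory Submission
  imports Defs
begin

text \<open>A direction-preserving map splits into two coordinates, each a \<^emph>\<open>potential\<close> on the board whose
  increment along an edge depends only on the direction. So the board is flexible iff it carries
  nontrivial potentials (with increments not proportional to \<open>(p, q)\<close>) in both coordinates; a
  generic combination with the identity is then injective. Whether a potential
  in the \<open>x\<close>-coordinate exists on \<open>m\<close> rows and \<open>n\<close> columns is decided by descent along the even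
  continued fraction: with \<open>q = c p + e\<close>, \<open>c\<close> even and \<open>\<bar>e\<bar> < p\<close>, gluing \<open>x\<close> to \<open>x + c p\<close> and \<open>y\<close> to
  \<open>y + c p\<close> turns a potential for the \<open>(p, q)\<close>-leaper into one for the \<open>(\<bar>e\<bar>, p)\<close>-leaper on a board
  with both sides shortened by \<open>q - \<bar>e\<bar>\<close>. The sides of \<open>A\<^sup>R\<^sub>i\<close> for \<open>i < \<kappa>\<close> shrink by the same amount.
  The new board \<open>A\<^sup>R\<^sub>\<kappa>\<close> has no potential because two rows
  at distance \<open>q\<close> contain a closed walk whose \<open>p\<close>-steps and \<open>q\<close>-steps do not cancel separately,
  and on boards that do not contain it the descent step can be inverted.\<close>

subsection \<open>Potentials\<close>

text \<open>A direction-preserving map from the \<open>(p, q)\<close>-leaper to the \<open>(a, b)\<close>-leaper has a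
  potential as its first coordinate. The increments \<open>a\<close> and \<open>b\<close> are arbitrary integers here, and \<open>x\<close>
  increases along every edge, so that each edge is considered once unless \<open>p = 0\<close>; in that
  case both orientations of an edge occur and force \<open>a = 0\<close>.\<close>

definition potential ::
    "int \<Rightarrow> int \<Rightarrow> int \<Rightarrow> int \<Rightarrow> int set \<Rightarrow> int set \<Rightarrow> (int \<Rightarrow> int \<Rightarrow> int) \<Rightarrow> bool" where
  "potential p q a b X Y g \<longleftrightarrow> (\<forall>x\<in>X. \<forall>y\<in>Y.
     (x + p \<in> X \<longrightarrow> (y + q \<in> Y \<longrightarrow> g (x + p) (y + q) = g x y + a) \<and>
                   (y - q \<in> Y \<longrightarrow> g (x + p) (y - q) = g x y + a)) \<and>
     (x + q \<in> X \<longrightarrow> (y + p \<in> Y \<longrightarrow> g (x + q) (y + p) = g x y + b) \<and>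
                   (y - p \<in> Y \<longrightarrow> g (x + q) (y - p) = g x y + b)))"

lemma potentialD:
  assumes "potential p q a b X Y g" "x \<in> X" "y \<in> Y"
  shows "x + p \<in> X \<Longrightarrow> y + q \<in> Y \<Longrightarrow> g (x + p) (y + q) = g x y + a"
    and "x + p \<in> X \<Longrightarrow> y - q \<in> Y \<Longrightarrow> g (x + p) (y - q) = g x y + a"
    and "x + q \<in> X \<Longrightarrow> y + p \<in> Y \<Longrightarrow> g (x + q) (y + p) = g x y + b"
    and "x + q \<in> X \<Longrightarrow> y - p \<in> Y \<Longrightarrow> g (x + q) (y - p) = g x y + b"
  using assms unfolding potential_def by blast+

lemma potentialI:
  assumes "\<And>x y. x \<in> X \<Longrightarrow> y \<in> Y \<Longrightarrow> x + p \<in> X \<Longrightarrow> y + q \<in> Y \<Longrightarrow> g (x + p) (y + q) = g x y + a"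
    and "\<And>x y. x \<in> X \<Longrightarrow> y \<in> Y \<Longrightarrow> x + p \<in> X \<Longrightarrow> y + q \<in> Y \<Longrightarrow> g (x + p) y = g x (y + q) + a"
    and "\<And>x y. x \<in> X \<Longrightarrow> y \<in> Y \<Longrightarrow> x + q \<in> X \<Longrightarrow> y + p \<in> Y \<Longrightarrow> g (x + q) (y + p) = g x y + b"
    and "\<And>x y. x \<in> X \<Longrightarrow> y \<in> Y \<Longrightarrow> x + q \<in> X \<Longrightarrow> y + p \<in> Y \<Longrightarrow> g (x + q) y = g x (y + p) + b"
  shows "potential p q a b X Y g"
  unfolding potential_def
proof (intro ballI conjI impI)
  fix x y assume xy: "x \<in> X" "y \<in> Y"
  show "g (x + p) (y + q) = g x y + a" if "x + p \<in> X" "y + q \<in> Y"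
    using assms(1) xy that by blast
  show "g (x + p) (y - q) = g x y + a" if "x + p \<in> X" "y - q \<in> Y"
    using assms(2)[of x "y - q"] xy that by simp
  show "g (x + q) (y + p) = g x y + b" if "x + q \<in> X" "y + p \<in> Y"
    using assms(3) xy that by blast
  show "g (x + q) (y - p) = g x y + b" if "x + q \<in> X" "y - p \<in> Y"
    using assms(4)[of x "y - p"] xy that by simp
qed

lemma potentialD':
  assumes "potential p q a b X Y g" "x \<in> X" "y \<in> Y"
  shows "x + p \<in> X \<Longrightarrow> y + q \<in> Y \<Longrightarrow> g (x + p) y = g x (y + q) + a"
    and "x + q \<in> X \<Longrightarrow> y + p \<in> Y \<Longrightarrow> g (x + q) y = g x (y + p) + b"
  using potentialD(2)[OF assms(1,2), of "y + q"] potentialD(4)[OF assms(1,2), of "y + p"] assms(3) by auto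

lemma potential_swap: "potential p q a b X Y g \<longleftrightarrow> potential q p b a X Y g"
  unfolding potential_def by blast

text \<open>A \<open>p\<close>-edge read backwards has \<open>x\<close>-increment
  \<open>- p\<close>, and its \<open>y\<close>-increment may have either sign. This covers the
  reduction with negative \<open>e\<close>.\<close>

lemma potential_neg:
  assumes "potential p q a b X Y g"
  shows "potential (- p) q (- a) b X Y g"
proof (rule potentialI)
  fix x y assume *: "x \<in> X" "y \<in> Y"
  show "g (x + - p) (y + q) = g x y + - a" if "x + - p \<in> X" "y + q \<in> Y"
    using potentialD'(1)[OF assms that(1) *(2)] * that by simp
  show "g (x + - p) y = g x (y + q) + - a" if "x + - p \<in> X" "y + q \<in> Y"
    using potentialD(1)[OF assms that(1) *(2)] * that by simp
  show "g (x + q) (y + - p) = g x y + b" if "x + q \<in> X" "y + - p \<in> Y"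
    using potentialD(4)[OF assms *] that by simp
  show "g (x + q) y = g x (y + - p) + b" if "x + q \<in> X" "y + - p \<in> Y"
    using potentialD(3)[OF assms *(1) that(2)] * that by simp
qed

lemma potential_translate:
  assumes "potential p q a b {x0..<x0 + n} {y0..<y0 + m} g"
  shows "potential p q a b {x1..<x1 + n} {y1..<y1 + m} (\<lambda>x y. g (x + (x0 - x1)) (y + (y0 - y1)))"
proof -
  have e: "u + r + t = u + t + r" for u r t :: int by simp
  show ?thesis
    by (rule potentialI; unfold e[of _ p] e[of _ q];
        rule potentialD[OF assms] potentialD'[OF assms]) auto
qed

text \<open>Splitting the sum of \<open>h\<close> over \<open>u + v\<close> points after
  \<open>u\<close> or after \<open>v\<close> points leaves the same two partial sums, plus
  \<open>v * A\<close> in one case and \<open>u * B\<close> in the other.\<close>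

lemma cycle_sum:
  fixes h :: "int \<Rightarrow> int"
  assumes "0 \<le> u" "0 \<le> v"
    and "\<And>x. 0 \<le> x \<Longrightarrow> x < v \<Longrightarrow> h (x + u) = h x + A"
    and "\<And>x. 0 \<le> x \<Longrightarrow> x < u \<Longrightarrow> h (x + v) = h x + B"
  shows "v * A = u * B"
proof -
  have split: "sum h {0..<u + v} = sum h {0..<s} + (\<Sum>x\<in>{0..<t}. h (x + s))"
    if "0 \<le> s" "0 \<le> t" "s + t = u + v" for s t
  proof -
    have "sum h {s..<s + t} = (\<Sum>x\<in>{0..<t}. h (x + s))"
      by (rule sum.reindex_bij_witness[of _ "\<lambda>x. x + s" "\<lambda>x. x - s"]) auto
    moreover have "{0..<u + v} = {0..<s} \<union> {s..<s + t}" using that by auto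
    ultimately show ?thesis by (simp add: sum.union_disjoint)
  qed
  have "(\<Sum>x\<in>{0..<v}. h (x + u)) = sum h {0..<v} + v * A"
    using assms by (simp add: sum.distrib)
  moreover have "(\<Sum>x\<in>{0..<u}. h (x + v)) = sum h {0..<u} + u * B"
    using assms by (simp add: sum.distrib)
  ultimately show ?thesis
    using split[of u v] split[of v u] assms(1,2) by simp
qed

text \<open>Adding up rows \<open>0\<close> and \<open>q\<close> gives a function of \<open>x\<close> with prescribed increments \<open>2a\<close> over \<open>p\<close>
  and \<open>4b\<close> over \<open>2q\<close>, to which lemma \<open>cycle_sum\<close> applies; when \<open>q\<close> is odd, even \<open>x\<close> suffice.\<close>

lemma potential_rigid_last:
  assumes g: "potential p q a b {0..<n} {0..<m} g" and p: "0 \<le> p" "p < q" and "odd (p + q)"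
    and m: "q + 1 \<le> m" and n: "p + 2 * q - q mod 2 \<le> n"
  shows "a * q = b * p"
proof -
  define h where "h = (\<lambda>x. g x 0 + g x q)"
  have hp: "h (x + p) = h x + 2 * a" if "0 \<le> x" "x + p < n" for x
  proof -
    have "g (x + p) (0 + q) = g x 0 + a" by (rule potentialD(1)[OF g]) (use that p m in auto)
    moreover have "g (x + p) 0 = g x (0 + q) + a" by (rule potentialD'(1)[OF g]) (use that p m in auto)
    ultimately show ?thesis by (simp add: h_def)
  qed
  have hq: "h (x + 2 * q) = h x + 4 * b" if "0 \<le> x" "x + 2 * q < n" for x
  proof -
    have "g (x + q) (0 + p) = g x 0 + b" by (rule potentialD(3)[OF g]) (use that p m in auto)
    moreover have "g ((x + q) + q) 0 = g (x + q) (0 + p) + b"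
      by (rule potentialD'(2)[OF g]) (use that p m in auto)
    moreover have "g (x + q) (q - p) = g x q + b" by (rule potentialD(4)[OF g]) (use that p m in auto)
    moreover have "g ((x + q) + q) ((q - p) + p) = g (x + q) (q - p) + b"
      by (rule potentialD(3)[OF g]) (use that p m in auto)
    ultimately show ?thesis by (simp add: h_def algebra_simps)
  qed
  show ?thesis
  proof (cases "even q")
    case True
    then have n: "p + 2 * q \<le> n" using n by (simp add: even_iff_mod_2_eq_zero)
    have "(2 * q) * (2 * a) = p * (4 * b)"
      by (rule cycle_sum[of _ _ h]) (use hp hq p n in auto)
    then show ?thesis by (simp add: mult.commute)
  next
    case False
    then obtain r where r: "p = 2 * r" using \<open>odd (p + q)\<close> by auto
    \<comment> \<open>As \<open>p\<close> is even, \<open>p + 2 * q - 1\<close> columns already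
      contain \<open>r + q\<close> even ones, hence the correction by
      \<open>q mod 2\<close>.\<close>
    have n: "p + 2 * q - 1 \<le> n" using n False by (simp add: odd_iff_mod_2_eq_one)
    have "q * (2 * a) = r * (4 * b)"
    proof (rule cycle_sum[of _ _ "\<lambda>x. h (2 * x)"])
      show "h (2 * (x + r)) = h (2 * x) + 2 * a" if "0 \<le> x" "x < q" for x
        using hp[of "2 * x"] that n r by (simp add: algebra_simps)
      show "h (2 * (x + q)) = h (2 * x) + 4 * b" if "0 \<le> x" "x < r" for x
        using hq[of "2 * x"] that n r by (simp add: algebra_simps)
    qed (use p r in auto)
    then show ?thesis using r by (simp add: mult.commute)
  qed
qed

text \<open>Two rows at distance \<open>q\<close> (or columns, after subtracting \<open>b\<close> from one of them) are joined by a
  zigzag of edges.\<close>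

definition zigzag :: "int \<Rightarrow> int \<Rightarrow> int set \<Rightarrow> (int \<Rightarrow> int) \<Rightarrow> (int \<Rightarrow> int) \<Rightarrow> bool" where
  "zigzag p a X f f' \<longleftrightarrow>
     (\<forall>x\<in>X. x + p \<in> X \<longrightarrow> f' (x + p) = f x + a \<and> f (x + p) = f' x + a)"

lemma zigzag_sym: "zigzag p a X f f' \<Longrightarrow> zigzag p a X f' f"
  by (auto simp: zigzag_def)

lemma zigzag_nat:
  assumes z: "zigzag p a {lo..<hi} f f'" and "0 \<le> p" "lo \<le> x" "x + int k * p < hi"
  shows "(even k \<longrightarrow> f (x + int k * p) = f x + int k * a) \<and>
         (odd k \<longrightarrow> f' (x + int k * p) = f x + int k * a)"
  using assms(4)
proof (induction k)
  case (Suc k)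
  have e: "x + int (Suc k) * p = (x + int k * p) + p" by (simp add: algebra_simps)
  have kp: "0 \<le> int k * p" using assms(2) by simp
  then have *: "x + int k * p \<in> {lo..<hi}" "(x + int k * p) + p \<in> {lo..<hi}"
    using Suc.prems assms(2,3) kp unfolding e atLeastLessThan_iff by linarith+
  have "x + int k * p < hi" using Suc.prems assms(2) unfolding e by linarith
  note IH = Suc.IH[OF this]
  have "f' ((x + int k * p) + p) = f (x + int k * p) + a"
    "f ((x + int k * p) + p) = f' (x + int k * p) + a"
    using z * unfolding zigzag_def by blast+
  then show ?case using IH unfolding e by (auto simp: algebra_simps)
qed simp

lemma zigzag_int:
  assumes z: "zigzag p a {lo..<hi} f f'" and "0 \<le> p"
    and x: "x \<in> {lo..<hi}" "x + k * p \<in> {lo..<hi}"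
  shows "even k \<Longrightarrow> f (x + k * p) = f x + k * a"
    and "odd k \<Longrightarrow> f' (x + k * p) = f x + k * a"
proof -
  have "(even k \<longrightarrow> f (x + k * p) = f x + k * a) \<and> (odd k \<longrightarrow> f' (x + k * p) = f x + k * a)"
  proof (cases "0 \<le> k")
    case True
    then show ?thesis using zigzag_nat[OF z \<open>0 \<le> p\<close>, of x "nat k"] x by (auto simp: even_nat_iff)
  next
    \<comment> \<open>For negative \<open>k\<close>, walk \<open>- k\<close> steps from the other
      end.\<close>
    case False
    then show ?thesis
      using zigzag_nat[OF z \<open>0 \<le> p\<close>, of "x + k * p" "nat (- k)"]
        zigzag_nat[OF zigzag_sym[OF z] \<open>0 \<le> p\<close>, of "x + k * p" "nat (- k)"] x
      by (auto simp: even_nat_iff)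
  qed
  then show "even k \<Longrightarrow> f (x + k * p) = f x + k * a"
    and "odd k \<Longrightarrow> f' (x + k * p) = f x + k * a" by blast+
qed

lemma potential_zigzag_row:
  assumes "potential p q a b X Y g" "y \<in> Y" "y + q \<in> Y"
  shows "zigzag p a X (\<lambda>x. g x y) (\<lambda>x. g x (y + q))"
  using potentialD(1)[OF assms(1) _ assms(2)] potentialD'(1)[OF assms(1) _ assms(2)] assms(3)
  by (auto simp: zigzag_def)

lemma potential_zigzag_col:
  assumes "potential p q a b X Y g" "x \<in> X" "x + q \<in> X"
  shows "zigzag p 0 Y (\<lambda>y. g x y) (\<lambda>y. g (x + q) y - b)"
  using potentialD(3)[OF assms(1) assms(2)] potentialD'(2)[OF assms(1) assms(2)] assms(3)
  by (auto simp: zigzag_def)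

subsection \<open>Reduction along the even continued fraction\<close>

text \<open>One step of the even continued fraction. Points \<open>x\<close> of the interval \<open>ivl n\<close> for the
  \<open>(\<bar>e\<bar>, p)\<close>-leaper stand for the points \<open>x\<close> and \<open>x + c p\<close> of \<open>[0, n)\<close>; only those that have a
  neighbour at distance \<open>q\<close> in \<open>[0, n)\<close> are relevant (\<open>live\<close>). Then \<open>x\<close> and \<open>x + e\<close> represent the ends
  of a \<open>q\<close>-step. Since \<open>c\<close> is even, a zigzag of \<open>c\<close> steps of length \<open>p\<close> ends in the row or
  column where it starts, so the two copies carry the same value up to \<open>c a\<close>.\<close>

locale leaper_step =
  fixes p q c e :: int
  assumes q_eq: "q = c * p + e" and even_c: "even c" and e_less: "- p < e" "e < p"
begin

text \<open>Both \<open>x\<close> and \<open>x + e\<close> lie in \<open>ivl n\<close> exactly when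
  \<open>x\<close> and \<open>x + q\<close> lie in [0, n). A negative \<open>e\<close> therefore
  lengthens the interval by \<open>\<bar>e\<bar>\<close> on both sides.\<close>

definition ivl :: "int \<Rightarrow> int set" where
  "ivl n = {min 0 e..<n - c * p - min 0 e}"

definition copy :: "bool \<Rightarrow> int \<Rightarrow> int" where
  "copy i x = x + of_bool i * c * p"

definition live :: "int \<Rightarrow> bool \<Rightarrow> int \<Rightarrow> bool" where
  "live n i x \<longleftrightarrow> (if i then q \<le> x + c * p \<and> x + c * p < n else 0 \<le> x \<and> x < n - q)"

lemma p_pos: "0 < p"
  using e_less by linarith

lemma copy_simps [simp]: "copy False x = x" "copy True x = x + c * p"
  by (simp_all add: copy_def)

lemma copy_shift: "copy i' (x + p) = copy i x + (1 + (of_bool i' - of_bool i) * c) * p"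
  by (simp add: copy_def algebra_simps)

lemma live_copy: "live n i x \<Longrightarrow> 0 \<le> q \<Longrightarrow> copy i x \<in> {0..<n}"
  by (auto simp: live_def split: if_splits)

lemma live_step_e:
  assumes "x \<in> ivl n" "x + e \<in> ivl n"
  shows "live n False x" "live n True (x + e)"
  using assms q_eq unfolding ivl_def live_def by (auto simp: min_def split: if_splits)

text \<open>A point of \<open>ivl n\<close> without a live copy is within distance
  \<open>\<bar>e\<bar> < p\<close> of both ends, so no \<open>p\<close>-step inside
  \<open>ivl n\<close> starts or ends there.\<close>

lemma live_step_p:
  assumes "x \<in> ivl n" "x + p \<in> ivl n"
  shows "\<exists>i. live n i x" "\<exists>i. live n i (x + p)"
proof -
  have "live n False x \<or> live n True x"
    using assms e_less q_eq unfolding ivl_def live_def by (auto simp: min_def split: if_splits)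
  then show "\<exists>i. live n i x" by blast
  have "live n False (x + p) \<or> live n True (x + p)"
    using assms e_less q_eq unfolding ivl_def live_def by (auto simp: min_def split: if_splits)
  then show "\<exists>i. live n i (x + p)" by blast
qed

lemma zigzag_row_live:
  assumes "potential p q a b X {0..<m} g" "live m j y" "0 \<le> q"
  shows "\<exists>f. zigzag p a X (\<lambda>x. g x (copy j y)) f"
proof (cases j)
  case True
  then have "zigzag p a X (\<lambda>x. g x (y + c * p - q)) (\<lambda>x. g x (y + c * p - q + q))"
    using assms by (intro potential_zigzag_row[OF assms(1)]) (auto simp: live_def)
  then show ?thesis using True by (auto intro: zigzag_sym)
next
  case False
  then have "zigzag p a X (\<lambda>x. g x y) (\<lambda>x. g x (y + q))"
    using assms by (intro potential_zigzag_row[OF assms(1)]) (auto simp: live_def)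
  then show ?thesis using False by auto
qed

lemma zigzag_col_live:
  assumes "potential p q a b {0..<n} Y g" "live n i x" "0 \<le> q"
  shows "\<exists>f. zigzag p 0 Y (\<lambda>y. g (copy i x) y) f"
proof (cases i)
  case True
  have "zigzag p 0 Y (\<lambda>y. g (x + c * p - q) y) (\<lambda>y. g (x + c * p - q + q) y - b)"
    using assms True by (intro potential_zigzag_col[OF assms(1)]) (auto simp: live_def)
  then have "zigzag p 0 Y (\<lambda>y. g (x + c * p) y) (\<lambda>y. g (x + c * p - q) y + b)"
    by (auto simp: zigzag_def)
  then show ?thesis using True by auto
next
  case False
  then have "zigzag p 0 Y (\<lambda>y. g x y) (\<lambda>y. g (x + q) y - b)"
    using assms by (intro potential_zigzag_col[OF assms(1)]) (auto simp: live_def)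
  then show ?thesis using False by auto
qed

section \<open>The potential of the smaller leaper\<close>

context
  fixes a b n m :: int and g :: "int \<Rightarrow> int \<Rightarrow> int"
  assumes g: "potential p q a b {0..<n} {0..<m} g" and q_nonneg: "0 \<le> q"
begin

text \<open>\<open>SOME\<close> picks a live copy; no edge of the smaller leaper meets a point
  without one. The term \<open>c * a\<close> compensates for the increment between the two copies of
  \<open>x\<close>; the copies of \<open>y\<close> agree without correction.\<close>

definition reduced :: "int \<Rightarrow> int \<Rightarrow> int" where
  "reduced x y = (let i = (SOME i. live n i x); j = (SOME j. live m j y)
     in g (copy i x) (copy j y) - of_bool i * c * a)"

lemma copy_x:
  assumes "live n False x" "live n True x" "live m j y"
  shows "g (copy True x) (copy j y) = g (copy False x) (copy j y) + c * a"
proof -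
  obtain f where f: "zigzag p a {0..<n} (\<lambda>x. g x (copy j y)) f"
    using zigzag_row_live[OF g assms(3) q_nonneg] by blast
  show ?thesis
    using zigzag_int(1)[OF f, of x c] p_pos even_c live_copy[OF assms(1) q_nonneg]
      live_copy[OF assms(2) q_nonneg] by simp
qed

lemma copy_y:
  assumes "live m False y" "live m True y" "live n i x"
  shows "g (copy i x) (copy True y) = g (copy i x) (copy False y)"
proof -
  obtain f where f: "zigzag p 0 {0..<m} (\<lambda>y. g (copy i x) y) f"
    using zigzag_col_live[OF g assms(3) q_nonneg] by blast
  show ?thesis
    using zigzag_int(1)[OF f, of y c] p_pos even_c live_copy[OF assms(1) q_nonneg]
      live_copy[OF assms(2) q_nonneg] by simp
qed

lemma reduced_eq:
  assumes "live n i x" "live m j y"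
  shows "reduced x y = g (copy i x) (copy j y) - of_bool i * c * a"
proof -
  define i' j' where "i' = (SOME i. live n i x)" and "j' = (SOME j. live m j y)"
  have l: "live n i' x" "live m j' y"
    using someI[of "\<lambda>i. live n i x"] someI[of "\<lambda>j. live m j y"] assms
    by (auto simp: i'_def j'_def)
  have "g (copy i x) (copy j y) - of_bool i * c * a = g (copy i' x) (copy j y) - of_bool i' * c * a"
    using copy_x[OF _ _ assms(2), of x] assms(1) l(1) by (cases i; cases i') auto
  moreover have "g (copy i' x) (copy j y) = g (copy i' x) (copy j' y)"
    using copy_y[OF _ _ l(1), of y] assms(2) l(2) by (cases j; cases j') auto
  ultimately show ?thesis by (simp add: reduced_def i'_def j'_def Let_def)
qed

text \<open>An \<open>e\<close>-step of \<open>x\<close> is the \<open>q\<close>-step from the lower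
  copy of \<open>x\<close> to the upper copy of \<open>x + e\<close>, whence
  \<open>b - c * a\<close>. In the coordinate that makes the \<open>p\<close>-step, the chosen live
  copies differ by an odd number of \<open>p\<close>-steps, and the zigzag gives their
  values.\<close>

lemma potential_reduced: "potential e p (b - c * a) a (ivl n) (ivl m) reduced"
proof (rule potentialI)
  fix x y assume xy: "x \<in> ivl n" "y \<in> ivl m"
  {
    assume *: "x + e \<in> ivl n" "y + p \<in> ivl m"
    note x = live_step_e[OF xy(1) *(1)]
    obtain j j' where y: "live m j y" "live m j' (y + p)"
      using live_step_p[OF xy(2) *(2)] by blast
    have xq: "x + e + c * p = x + q" by (simp add: q_eq)
    have xx: "x \<in> {0..<n}" "x + q \<in> {0..<n}"
      using x q_nonneg by (auto simp: live_def xq)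
    note z = potential_zigzag_col[OF g xx]
    define k where "k = 1 + (of_bool j' - of_bool j) * c"
    have "odd k" using even_c by (simp add: k_def)
    have shift: "copy j' (y + p) = copy j y + k * p" by (simp add: k_def copy_shift)
    have yy: "copy j y \<in> {0..<m}" "copy j y + k * p \<in> {0..<m}"
      using live_copy[OF y(1) q_nonneg] live_copy[OF y(2) q_nonneg] by (simp_all add: shift)
    have "g (x + q) (copy j y + k * p) - b = g x (copy j y) + k * 0"
      using zigzag_int(2)[OF z _ yy \<open>odd k\<close>] p_pos by simp
    then show "reduced (x + e) (y + p) = reduced x y + (b - c * a)"
      by (simp add: reduced_eq[OF x(1) y(1)] reduced_eq[OF x(2) y(2)] shift xq)
    have "g x (copy j y + k * p) = g (x + q) (copy j y) - b + k * 0"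
      using zigzag_int(2)[OF zigzag_sym[OF z] _ yy \<open>odd k\<close>] p_pos by simp
    then show "reduced (x + e) y = reduced x (y + p) + (b - c * a)"
      by (simp add: reduced_eq[OF x(1) y(2)] reduced_eq[OF x(2) y(1)] shift xq)
  }
  {
    assume *: "x + p \<in> ivl n" "y + e \<in> ivl m"
    note y = live_step_e[OF xy(2) *(2)]
    obtain i i' where x: "live n i x" "live n i' (x + p)"
      using live_step_p[OF xy(1) *(1)] by blast
    have yq: "y + e + c * p = y + q" by (simp add: q_eq)
    have yy: "y \<in> {0..<m}" "y + q \<in> {0..<m}"
      using y q_nonneg by (auto simp: live_def yq)
    note z = potential_zigzag_row[OF g yy]
    define k where "k = 1 + (of_bool i' - of_bool i) * c"
    have "odd k" using even_c by (simp add: k_def)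
    have shift: "copy i' (x + p) = copy i x + k * p" by (simp add: k_def copy_shift)
    have ka: "k * a = a + of_bool i' * c * a - of_bool i * c * a" by (simp add: k_def algebra_simps)
    have xx: "copy i x \<in> {0..<n}" "copy i x + k * p \<in> {0..<n}"
      using live_copy[OF x(1) q_nonneg] live_copy[OF x(2) q_nonneg] by (simp_all add: shift)
    have "g (copy i x + k * p) (y + q) = g (copy i x) y + k * a"
      using zigzag_int(2)[OF z _ xx \<open>odd k\<close>] p_pos by simp
    then show "reduced (x + p) (y + e) = reduced x y + a"
      by (simp add: reduced_eq[OF x(1) y(1)] reduced_eq[OF x(2) y(2)] shift yq ka)
    have "g (copy i x + k * p) y = g (copy i x) (y + q) + k * a"
      using zigzag_int(2)[OF zigzag_sym[OF z] _ xx \<open>odd k\<close>] p_pos by simp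
    then show "reduced (x + p) y = reduced x (y + e) + a"
      by (simp add: reduced_eq[OF x(1) y(2)] reduced_eq[OF x(2) y(1)] shift yq ka)
  }
qed

end

end

subsection \<open>Inverting the reduction\<close>

text \<open>In the cyclic order \<open>N - 1, N - 1 + u, N - 1 + 2u, \<dots>\<close> modulo \<open>N = u + v\<close>, both kinds of steps join
  consecutive residues. Removing the residue \<open>N - 1\<close> opens the cycle into a path.\<close>

lemma two_step_potential:
  fixes u v A B :: int
  assumes "0 < u" "0 < v" "coprime u v"
  shows "\<exists>h. \<forall>x\<ge>0. (x + u < u + v - 1 \<longrightarrow> h (x + u) = h x + A) \<and>
                    (x + v < u + v - 1 \<longrightarrow> h (x + v) = h x + B)"
proof -
  define N where "N = u + v"
  define R where "R = (\<lambda>x j k. 0 \<le> j \<and> j < N \<and> x = N - 1 + j * u - k * N)"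
  have N: "0 < N" using assms by (simp add: N_def)
  have cop: "coprime N u" using assms(3) by (metis N_def coprime_commute coprime_iff_gcd_eq_1 gcd_add2)
  obtain s t where st: "s * u + t * N = 1"
    using bezout_int[of u N] cop by (auto simp: coprime_iff_gcd_eq_1 gcd.commute)
  have ex: "\<exists>j k. R x j k" for x
  proof -
    define z where "z = x - (N - 1)"
    have "z = (s * z) * u + t * z * N"
      using st by (metis distrib_right mult.assoc mult.commute mult_1)
    also have "s * z = N * (s * z div N) + s * z mod N" by simp
    finally have "z = (s * z mod N) * u - (- (t * z) - (s * z div N) * u) * N"
      by (simp only: algebra_simps)
    then have "R x (s * z mod N) (- (t * z) - (s * z div N) * u)"
      using N by (simp add: R_def z_def)
    then show ?thesis by blast
  qed
  have uniq: "j = j' \<and> k = k'" if "R x j k" "R x j' k'" for x j k j' k'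
  proof -
    have eq: "(j - j') * u = (k - k') * N" using that by (simp add: R_def algebra_simps)
    then have "N dvd (j - j') * u" by simp
    then have "N dvd j - j'" using cop by (simp add: coprime_dvd_mult_left_iff)
    moreover have "\<bar>j - j'\<bar> < N" using that by (auto simp: R_def)
    ultimately have "j = j'" using zdvd_imp_le[of N "\<bar>j - j'\<bar>"] by fastforce
    then show ?thesis using eq N by simp
  qed
  obtain J K where JK: "\<And>x. R x (J x) (K x)" using ex by metis
  \<comment> \<open>Since \<open>x = N - 1 + (j - k) * u - k * v\<close>, the path to
    \<open>x\<close> makes \<open>j - k\<close> steps \<open>+ u\<close> and \<open>k\<close> steps
    \<open>- v\<close>.\<close>
  define h where "h = (\<lambda>x. (J x - K x) * A - K x * B)"
  have "h (x + u) = h x + A" if "0 \<le> x" "x + u < N - 1" for x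
  proof -
    \<comment> \<open>From the last position of the cycle, a step \<open>+ u\<close> would reach the
      removed residue \<open>N - 1\<close>.\<close>
    have "J x \<noteq> N - 1"
    proof
      assume "J x = N - 1"
      then have eq: "x + u = N - 1 + (u - K x) * N"
        using JK[of x] unfolding R_def by (simp add: left_diff_distrib) (simp add: algebra_simps)
      show False
      proof (cases "u - K x \<ge> 0")
        case True
        then have "0 \<le> (u - K x) * N" using N by simp
        then show False using eq that by linarith
      next
        case False
        then have "(u - K x) * N \<le> - 1 * N" using N by (intro mult_right_mono) auto
        then show False using eq that assms(1) by linarith
      qed
    qed
    then have "R (x + u) (J x + 1) (K x)" using JK[of x] by (auto simp: R_def algebra_simps)
    then have "J (x + u) = J x + 1 \<and> K (x + u) = K x" using uniq[OF JK] by blast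
    then show ?thesis by (simp add: h_def algebra_simps)
  qed
  moreover have "h (x + v) = h x + B" if "0 \<le> x" "x + v < N - 1" for x
  proof -
    have "J x \<noteq> 0"
    proof
      assume "J x = 0"
      then have eq: "x = N - 1 - K x * N" using JK[of x] by (simp add: R_def)
      show False
      proof (cases "K x \<le> 0")
        case True
        then have "K x * N \<le> 0" using N by (simp add: mult_le_0_iff)
        then show False using eq that assms(2) by linarith
      next
        case False
        then have "1 * N \<le> K x * N" using N by (intro mult_right_mono) auto
        then show False using eq that by linarith
      qed
    qed
    then have "R (x + v) (J x - 1) (K x - 1)"
      using JK[of x] by (auto simp: R_def N_def algebra_simps)
    then have JK': "J (x + v) = J x - 1" "K (x + v) = K x - 1" using uniq[OF JK] by blast+
    show ?thesis unfolding h_def JK' by (simp add: algebra_simps)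
  qed
  ultimately show ?thesis unfolding N_def by blast
qed

text \<open>For even \<open>q\<close>, the steps \<open>p\<close> and \<open>2 * q\<close> are
  coprime; for odd \<open>q\<close>, passing to \<open>x div 2\<close> halves both to coprime steps.
  The bound on \<open>n\<close> is the negation of the width condition in
  \<open>potential_rigid_last\<close>.\<close>

lemma double_step_potential:
  fixes p q n a b :: int
  assumes pq: "0 < p" "0 < q" "coprime p q" "odd (p + q)" and n: "n < p + 2 * q - q mod 2"
  shows "\<exists>h. \<forall>x\<ge>0. (x + p < n \<longrightarrow> h (x + p) = h x + a) \<and>
                    (x + 2 * q < n \<longrightarrow> h (x + 2 * q) = h x + 2 * b)"
proof (cases "even q")
  case True
  then have "odd p" using pq(4) by simp
  then have "coprime p (2 * q)" using pq(3) by (simp add: coprime_commute)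
  then obtain h where h: "\<forall>x\<ge>0. (x + p < p + 2 * q - 1 \<longrightarrow> h (x + p) = h x + a) \<and>
      (x + 2 * q < p + 2 * q - 1 \<longrightarrow> h (x + 2 * q) = h x + 2 * b)"
    using two_step_potential[of p "2 * q"] pq by fastforce
  have "n \<le> p + 2 * q - 1" using n True by (simp add: even_iff_mod_2_eq_zero)
  then show ?thesis using h by (intro exI[of _ h]) fastforce
next
  case False
  then obtain r where r: "p = 2 * r" using pq(4) by auto
  then have "coprime r q" "0 < r" using pq by auto
  then obtain h where h: "\<forall>x\<ge>0. (x + r < r + q - 1 \<longrightarrow> h (x + r) = h x + a) \<and>
      (x + q < r + q - 1 \<longrightarrow> h (x + q) = h x + 2 * b)"
    using two_step_potential[of r q] pq by fastforce
  have n: "n \<le> 2 * (r + q - 1)" using n False r by (simp add: odd_iff_mod_2_eq_one)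
  have half: "z div 2 < k" if "z < 2 * k" for z k :: int
    using that by auto
  show ?thesis
  proof (intro exI[of _ "\<lambda>x. h (x div 2)"] allI impI conjI)
    fix x :: int assume x: "0 \<le> x"
    have d: "(x + p) div 2 = x div 2 + r" "(x + 2 * q) div 2 = x div 2 + q" using r by auto
    show "h ((x + p) div 2) = h (x div 2) + a" if "x + p < n"
    proof -
      have "(x + p) div 2 < r + q - 1" using that n by (intro half) simp
      then show ?thesis using h x unfolding d by simp
    qed
    show "h ((x + 2 * q) div 2) = h (x div 2) + 2 * b" if "x + 2 * q < n"
    proof -
      have "(x + 2 * q) div 2 < r + q - 1" using that n by (intro half) simp
      then show ?thesis using h x unfolding d by simp
    qed
  qed
qed

section \<open>The lifted potential on boards with at most \<open>p + q\<close> rows\<close>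

context leaper_step
begin

context
  fixes a b n m :: int and g :: "int \<Rightarrow> int \<Rightarrow> int" and h :: "int \<Rightarrow> int"
  assumes g: "potential e p (b - c * a) a (ivl n) (ivl m) g" and p_less_q: "p < q"
    and m: "m \<le> p + q"
    and h_p: "\<And>x. 0 \<le> x \<Longrightarrow> x + p < n \<Longrightarrow> h (x + p) = h x + a"
    and h_q: "\<And>x. 0 \<le> x \<Longrightarrow> x + 2 * q < n \<Longrightarrow> h (x + 2 * q) = h x + 2 * b"
begin

text \<open>The common extension of two rows to all of \<open>\<int>\<close>, reduced to a window of length \<open>p\<close>. Where the
  window is not contained in \<open>ivl n\<close>, arbitrary values of \<open>g\<close> are used, which does no harm.\<close>

definition ext :: "int \<Rightarrow> int \<Rightarrow> int \<Rightarrow> int" where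
  "ext w w' x = (let k = (x - min 0 e) div p; r = min 0 e + (x - min 0 e) mod p
     in k * a + (if even k then g r w else g r w'))"

lemma ext_step: "ext w' w (x + p) = ext w w' x + a"
proof -
  have "x + p - min 0 e = (x - min 0 e) + p" by simp
  moreover have "((x - min 0 e) + p) div p = (x - min 0 e) div p + 1"
    using p_pos by simp
  moreover have "((x - min 0 e) + p) mod p = (x - min 0 e) mod p" by simp
  ultimately have "ext w' w (x + p) = (let k = (x - min 0 e) div p + 1;
      r = min 0 e + (x - min 0 e) mod p in k * a + (if even k then g r w' else g r w))"
    unfolding ext_def by (metis (no_types))
  then show ?thesis by (auto simp: ext_def Let_def algebra_simps)
qed

lemma ext_even:
  assumes "even k"
  shows "ext w w' (x + k * p) = ext w w' x + k * a"
proof -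
  have z: "zigzag p a {min x (x + k * p)..<max x (x + k * p) + 1} (ext w w') (ext w' w)"
    using ext_step by (simp add: zigzag_def)
  show ?thesis
    by (rule zigzag_int(1)[OF z]) (use assms p_pos in auto)
qed

lemma ext_eq:
  assumes z: "zigzag p a (ivl n) (\<lambda>x. g x w) (\<lambda>x. g x w')" and x: "x \<in> ivl n"
  shows "ext w w' x = g x w"
proof -
  define k where "k = (x - min 0 e) div p"
  define r where "r = min 0 e + (x - min 0 e) mod p"
  have xr: "x = r + k * p" using mult_div_mod_eq[of p "x - min 0 e"] by (simp add: r_def k_def algebra_simps)
  have "0 \<le> k" using x p_pos by (simp add: k_def ivl_def pos_imp_zdiv_nonneg_iff)
  then have "0 \<le> k * p" using p_pos by simp
  moreover have "min 0 e \<le> r" using p_pos by (simp add: r_def)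
  ultimately have r: "r \<in> ivl n" using x xr by (auto simp: ivl_def)
  have "ext w w' x = k * a + (if even k then g r w else g r w')"
    by (simp add: ext_def Let_def k_def r_def)
  moreover have "even k \<Longrightarrow> g (r + k * p) w = g r w + k * a"
    "odd k \<Longrightarrow> g (r + k * p) w = g r w' + k * a"
    using zigzag_int(1)[OF z[unfolded ivl_def], of r k] zigzag_int(2)[OF zigzag_sym[OF z[unfolded ivl_def]], of r k]
      p_pos r x xr by (auto simp: ivl_def)
  ultimately show ?thesis using xr by auto
qed

text \<open>For \<open>0 \<le> y < m - q\<close>, \<open>low y\<close> and \<open>high y\<close> are
  candidates for the rows \<open>y\<close> and \<open>y + q\<close> of the large board, which the
  smaller board represents by \<open>y\<close> and \<open>y + e\<close>.\<close>

definition low :: "int \<Rightarrow> int \<Rightarrow> int" where "low y = ext y (y + e)"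
definition high :: "int \<Rightarrow> int \<Rightarrow> int" where "high y = ext (y + e) y"

lemma low_high_step:
  "high y (x + p) = low y x + a" "low y (x + p) = high y x + a"
  by (simp_all add: low_def high_def ext_step)

lemma row_ivl:
  assumes "0 \<le> y" "y < m - q"
  shows "y \<in> ivl m" "y + e \<in> ivl m"
  using assms q_eq by (auto simp: ivl_def)

lemma col_ivl:
  assumes "0 \<le> x" "x < n - q"
  shows "x \<in> ivl n" "x + e \<in> ivl n"
  using assms q_eq by (auto simp: ivl_def)

lemma low_high_eq:
  assumes y: "0 \<le> y" "y < m - q" and x: "0 \<le> x" "x < n - q"
  shows "low y x = g x y" "high y x = g x (y + e)"
    "low y (x + q) = g (x + e) y + c * a" "high y (x + q) = g (x + e) (y + e) + c * a"
proof -
  have z: "zigzag p a (ivl n) (\<lambda>x. g x y) (\<lambda>x. g x (y + e))"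
    using potential_zigzag_row[OF _ row_ivl[OF y]] g potential_swap by blast
  note E = ext_eq[OF z] ext_eq[OF zigzag_sym[OF z]]
  have xq: "x + q = (x + e) + c * p" by (simp add: q_eq)
  show "low y x = g x y" "high y x = g x (y + e)"
    using E col_ivl[OF x] by (simp_all add: low_def high_def)
  show "low y (x + q) = g (x + e) y + c * a" "high y (x + q) = g (x + e) (y + e) + c * a"
    using E col_ivl[OF x] unfolding low_def high_def xq ext_even[OF even_c] by simp_all
qed

text \<open>Runs of \<open>p\<close>-steps in the \<open>y\<close>-direction force the increment \<open>2b\<close> over \<open>2q\<close> on the rows \<open>y\<close> and
  \<open>y + q\<close>. Where the rows taken from \<open>g\<close> fail to have it, no step of the smaller leaper connects
  them to other rows by a \<open>p\<close>-step in the \<open>y\<close>-direction, and \<open>h\<close> can be used instead.\<close>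

definition good :: "int \<Rightarrow> bool" where
  "good y \<longleftrightarrow> (\<forall>x. 0 \<le> x \<longrightarrow> x + 2 * q < n \<longrightarrow>
     low y (x + 2 * q) = low y x + 2 * b \<and> high y (x + 2 * q) = high y x + 2 * b)"

definition low' :: "int \<Rightarrow> int \<Rightarrow> int" where "low' y = (if good y then low y else h)"
definition high' :: "int \<Rightarrow> int \<Rightarrow> int" where "high' y = (if good y then high y else h)"

lemma low'_high'_step:
  assumes "0 \<le> x" "x + p < n"
  shows "high' y (x + p) = low' y x + a" "low' y (x + p) = high' y x + a"
  using assms h_p by (simp_all add: low'_def high'_def low_high_step)

lemma low'_high'_2q:
  assumes "0 \<le> x" "x + 2 * q < n"
  shows "low' y (x + 2 * q) = low' y x + 2 * b" "high' y (x + 2 * q) = high' y x + 2 * b"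
  using assms h_q by (simp_all add: low'_def high'_def good_def)

text \<open>Two \<open>q\<close>-steps lead from \<open>f\<close> to \<open>t\<close> and back. For
  \<open>f'\<close>, the walk first enters \<open>f\<close> by a \<open>p\<close>-step; moving by
  \<open>2 * p\<close> within \<open>t\<close> between the \<open>q\<close>-steps keeps it inside
  the board.\<close>

lemma quasi_periodic_cross:
  fixes f f' t t' :: "int \<Rightarrow> int"
  assumes f: "\<And>x. f' (x + p) = f x + a" "\<And>x. f (x + p) = f' x + a"
    and t: "\<And>x. t' (x + p) = t x + a" "\<And>x. t (x + p) = t' x + a"
    and ft: "\<And>x. 0 \<le> x \<Longrightarrow> x < n - q \<Longrightarrow> t (x + q) = f x + b"
      "\<And>x. 0 \<le> x \<Longrightarrow> x < n - q \<Longrightarrow> f (x + q) = t x + b"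
    and x: "0 \<le> x" "x + 2 * q < n"
  shows "f (x + 2 * q) = f x + 2 * b" "f' (x + 2 * q) = f' x + 2 * b"
proof -
  have q0: "0 < q" using p_pos p_less_q by simp
  show "f (x + 2 * q) = f x + 2 * b"
    using ft(1)[of x] ft(2)[of "x + q"] x q0 by (simp add: algebra_simps)
  have "f' (x + 2 * q) = f (x + (q - p) + q) + a"
    using f(1)[of "x + 2 * q - p"] by (simp add: algebra_simps)
  also have "f (x + (q - p) + q) = t (x + (q - p)) + b"
    using ft(2)[of "x + (q - p)"] x p_less_q p_pos by simp
  also have "t (x + (q - p)) = t (x + p + q) - 2 * a"
    using t(1)[of "x + (q - p)"] t(2)[of "x + q"] by (simp add: algebra_simps)
  also have "t (x + p + q) = f (x + p) + b"
    using ft(1)[of "x + p"] x p_less_q p_pos by simp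
  also have "f (x + p) = f' x + a" by (rule f(2))
  finally show "f' (x + 2 * q) = f' x + 2 * b" by simp
qed

text \<open>The rows of the board form runs with step \<open>p\<close>. If both ends of a run have \<open>q\<close>-steps, then the
  run has \<open>c\<close> steps and its ends are copies of the same row, or \<open>c \<plusminus> 1\<close> steps and its ends
  correspond to a \<open>p\<close>-step of the smaller leaper.\<close>

lemma same_run_even:
  assumes y: "0 \<le> y" "y < m - q" and y': "0 \<le> y - e" "y - e < m - q"
    and x: "0 \<le> x" "x < n" "x < n - q \<or> q \<le> x"
  shows "high' (y - e) x = low' y x"
proof -
  have eq: "high (y - e) x = low y x" if "0 \<le> x" "x < n" "x < n - q \<or> q \<le> x" for x
    using that(3)
  proof
    assume "x < n - q"
    then show ?thesis using low_high_eq(1)[OF y] low_high_eq(2)[OF y'] that by simp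
  next
    assume "q \<le> x"
    then show ?thesis using low_high_eq(3)[OF y, of "x - q"] low_high_eq(4)[OF y', of "x - q"] that by simp
  qed
  have "good (y - e) = good y"
  proof (cases "2 * q < n")
    case False
    then show ?thesis by (auto simp: good_def)
  next
    case True
    \<comment> \<open>As \<open>2 * q < n\<close>, each column has another column of the board at
      distance \<open>q\<close>.\<close>
    have eq1: "high (y - e) x = low y x" if "0 \<le> x" "x < n" for x
      using eq[of x] that True by (cases "x < n - q") auto
    have eq2: "low (y - e) x = high y x" if "0 \<le> x" "x < n" for x
    proof (cases "x + p < n")
      case True
      then show ?thesis using eq1[of "x + p"] low_high_step(1)[of "y - e" x] low_high_step(2)[of y x] that p_pos by simp
    next
      case False
      then have "0 \<le> x - p" using True p_less_q by simp
      then show ?thesis using eq1[of "x - p"] low_high_step(2)[of "y - e" "x - p"] low_high_step(1)[of y "x - p"]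
          that p_pos by simp
    qed
    show ?thesis unfolding good_def using eq1 eq2 p_pos p_less_q by (smt (verit))
  qed
  then show ?thesis using eq[OF x] by (simp add: low'_def high'_def)
qed

text \<open>The \<open>p\<close>-step between rows \<open>y\<close> and \<open>z + e\<close> of the
  smaller board links \<open>low y\<close> and \<open>high z\<close> across every
  \<open>q\<close>-step. By \<open>quasi_periodic_cross\<close> both rows are then good, so
  \<open>h\<close> replaces neither.\<close>

lemma same_run_odd:
  assumes y: "0 \<le> y" "y < m - q" and z: "0 \<le> z" "z < m - q"
    and yz: "z + e = y + p \<or> z + e = y - p"
    and x: "0 \<le> x" "x < n - q"
  shows "high' z (x + q) = low' y x + b" "low' y (x + q) = high' z x + b"
proof -
  have ft: "high z (x + q) = low y x + b" "low y (x + q) = high z x + b"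
    if x: "0 \<le> x" "x < n - q" for x
  proof -
    note X = col_ivl[OF x] and Y = row_ivl(1)[OF y] and Z = row_ivl(2)[OF z]
    have "g (x + e) (z + e) = g x y + (b - c * a)"
      using potentialD(1,2)[OF g X(1) Y X(2)] yz Z by auto
    then show "high z (x + q) = low y x + b"
      using low_high_eq[OF y x] low_high_eq[OF z x] by simp
    have "g (x + e) y = g x (z + e) + (b - c * a)"
      using potentialD(1,2)[OF g X(1) Z X(2)] yz Y by auto
    then show "low y (x + q) = high z x + b"
      using low_high_eq[OF y x] low_high_eq[OF z x] by simp
  qed
  have "good y" unfolding good_def
    using quasi_periodic_cross[OF low_high_step[of y] low_high_step(2,1)[of z] ft] by blast
  moreover have "good z" unfolding good_def
    using quasi_periodic_cross[OF low_high_step(2,1)[of z] low_high_step[of y] ft(2,1)] by blast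
  ultimately show "high' z (x + q) = low' y x + b" "low' y (x + q) = high' z x + b"
    using ft[OF x] by (simp_all add: low'_def high'_def)
qed

text \<open>The values forced on a row at distance \<open>p\<close> from a row with values
  \<open>f\<close>, read off a column at distance \<open>q\<close>. If there are two such columns,
  \<open>qp f\<close> makes them agree; if there is none, the value has no meaning.\<close>

definition twist :: "(int \<Rightarrow> int) \<Rightarrow> int \<Rightarrow> int" where
  "twist f x = (if x + q < n then f (x + q) - b else f (x - q) + b)"

definition qp :: "(int \<Rightarrow> int) \<Rightarrow> bool" where
  "qp f \<longleftrightarrow> (\<forall>x. 0 \<le> x \<longrightarrow> x + 2 * q < n \<longrightarrow> f (x + 2 * q) = f x + 2 * b)"

lemma twist_step:
  assumes "qp f" "0 \<le> x" "x + q < n"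
  shows "twist f (x + q) = f x + b" "f (x + q) = twist f x + b"
  using assms by (auto simp: twist_def qp_def algebra_simps)

lemma qp_twist: 
  assumes "qp f" shows "qp (twist f)"
  unfolding qp_def
proof (intro allI impI)
  fix x assume x: "0 \<le> x" "x + 2 * q < n"
  have "0 < q" using p_pos p_less_q by simp
  then show "twist f (x + 2 * q) = twist f x + 2 * b"
    using twist_step(1)[OF assms, of "x + q"] twist_step(2)[OF assms, of x] x by (simp add: algebra_simps)
qed

lemma qp_funs: "qp (low' y)" "qp (high' y)" "qp h"
  using low'_high'_2q h_q by (auto simp: qp_def)

lemma twist_twist:
  assumes "qp f" "0 \<le> x" "x < n" "x < n - q \<or> q \<le> x"
  shows "twist (twist f) x = f x"
proof (cases "x + q < n")
  case True
  then show ?thesis using twist_step(1)[OF assms(1,2)] by (simp add: twist_def[of "twist f"])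
next
  case False
  then show ?thesis using twist_step(2)[OF assms(1), of "x - q"] assms
    by (simp add: twist_def[of "twist f"])
qed

definition steps :: "int \<Rightarrow> int" where
  "steps y = (m - 1 - y) div p"

text \<open>For the first row \<open>y\<close> of a run: values come from its own
  \<open>q\<close>-steps, or else are carried back from the last row of the run. Only the parity of
  \<open>steps y\<close> counts, since two twists cancel. If neither end has \<open>q\<close>-steps,
  the run is free and gets \<open>h\<close>.\<close>

definition base :: "int \<Rightarrow> int \<Rightarrow> int" where
  "base y = (if y < m - q then low' y
     else if q \<le> y + steps y * p then
       (if even (steps y) then high' (y + steps y * p - q) else twist (high' (y + steps y * p - q)))
     else h)"

definition run :: "int \<Rightarrow> int \<Rightarrow> int" where
  "run x y = (if even (y div p) then base (y mod p) x else twist (base (y mod p)) x)"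

text \<open>Rows with a partner at distance \<open>q\<close> keep \<open>low'\<close> and
  \<open>high'\<close> on all columns, because \<open>p\<close>-steps in the
  \<open>x\<close>-direction also meet columns without a \<open>q\<close>-neighbour, where
  \<open>run\<close> may differ.\<close>

definition lifted :: "int \<Rightarrow> int \<Rightarrow> int" where
  "lifted x y = (if y < m - q then low' y x else if q \<le> y then high' (y - q) x else run x y)"

lemma qp_base: "qp (base y)"
  using qp_funs qp_twist by (simp add: base_def)

lemma run_step:
  assumes "0 \<le> x" "x + q < n"
  shows "run (x + q) (y + p) = run x y + b" "run (x + q) y = run x (y + p) + b"
  using twist_step[OF qp_base assms] p_pos by (auto simp: run_def)

text \<open>The critical runs are those with \<open>q\<close>-steps at both ends:
  \<open>base\<close> follows the first row, and \<open>same_run_even\<close> or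
  \<open>same_run_odd\<close> shows that the last row agrees.\<close>

lemma lifted_eq_run:
  assumes y: "0 \<le> y" "y < m" and x: "0 \<le> x" "x < n" "x < n - q \<or> q \<le> x"
  shows "lifted x y = run x y"
proof -
  consider "y < m - q" | "q \<le> y" "\<not> y < m - q" | "\<not> y < m - q" "\<not> q \<le> y" by blast
  then show ?thesis
  proof cases
    case 1
    then have "y < p" using m by simp
    then have "y div p = 0" "y mod p = y" using y by auto
    then show ?thesis using 1 by (simp add: lifted_def run_def base_def)
  next
    case 2
    define y0 where "y0 = y mod p"
    define d where "d = y div p"
    have y0: "0 \<le> y0" "y0 < p" using p_pos by (auto simp: y0_def)
    have yd: "y = y0 + d * p" using mult_div_mod_eq[of p y] by (simp add: y0_def d_def algebra_simps)
    have "m - 1 - y0 = (m - 1 - y) + d * p" using yd by simp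
    then have "steps y0 = (m - 1 - y + d * p) div p" by (simp only: steps_def)
    \<comment> \<open>Row \<open>y\<close> is the last of its run, as
      \<open>m - 1 - y < p\<close>.\<close>
    also have "\<dots> = d" using 2 y m p_pos by simp
    finally have st: "steps y0 = d" .
    have L: "lifted x y = high' (y - q) x" using 2 by (simp add: lifted_def)
    show ?thesis
    proof (cases "y0 < m - q")
      case True
      then have run: "run x y = (if even d then low' y0 x else twist (low' y0) x)"
        by (simp add: run_def base_def y0_def d_def)
      \<comment> \<open>Since \<open>y - q\<close> and \<open>y0\<close> lie in [0, p) and
        \<open>\<bar>e\<bar> < p\<close>, this leaves only -1, 0 and 1 for
        \<open>d - c\<close>.\<close>
      have dp: "(d - c) * p = (y - q) - (y0 - e)" using q_eq yd by (simp add: algebra_simps)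
      have "(d - c) * p < 2 * p"
        unfolding dp using y y0 m e_less by linarith
      then have "d - c < 2" using p_pos by simp
      have "- 2 * p < (d - c) * p"
        unfolding dp using y y0 m e_less True 2 by linarith
      then have "- 2 < d - c" using p_pos by (metis mult_less_cancel_right_pos)
      have z: "0 \<le> y - q" "y - q < m - q" using y 2 by auto
      show ?thesis
      proof (cases "even d")
        case True
        then have "even (d - c)" using even_c by simp
        then have "d - c = 0" using \<open>d - c < 2\<close> \<open>- 2 < d - c\<close> by presburger
        then have "d = c" by simp
        then have "y - q = y0 - e" using dp by simp
        then show ?thesis
          using same_run_even[OF y0(1) \<open>y0 < m - q\<close> _ _ x] z L run True by simp
      next
        case False
        then have "odd (d - c)" using even_c by simp
        then have "d - c = 1 \<or> d - c = - 1" using \<open>d - c < 2\<close> \<open>- 2 < d - c\<close> by presburger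
        then have yz: "(y - q) + e = y0 + p \<or> (y - q) + e = y0 - p" using dp by auto
        note odd = same_run_odd[OF y0(1) \<open>y0 < m - q\<close> z yz]
        show ?thesis
        proof (cases "x + q < n")
          case True
          then show ?thesis using odd(2)[of x] x run L \<open>odd d\<close> by (simp add: twist_def)
        next
          case False
          then show ?thesis using odd(1)[of "x - q"] x run L \<open>odd d\<close> by (simp add: twist_def)
        qed
      qed
    next
      case False
      then have "base y0 = (if even d then high' (y - q) else twist (high' (y - q)))"
        using 2 st yd by (simp add: base_def)
      then show ?thesis using L twist_twist[OF qp_funs(2) x]
        by (simp add: run_def y0_def[symmetric] d_def[symmetric])
    qed
  next
    case 3
    then show ?thesis by (simp add: lifted_def)
  qed
qed

text \<open>A \<open>p\<close>-step in \<open>x\<close> joins rows given by \<open>low'\<close> and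
  \<open>high'\<close>. A \<open>q\<close>-step in \<open>x\<close> meets only columns with a
  \<open>q\<close>-neighbour, where \<open>run\<close> describes all rows.\<close>

lemma potential_lifted: "potential p q a b {0..<n} {0..<m} lifted"
proof (rule potentialI)
  fix x y assume xy: "x \<in> {0..<n}" "y \<in> {0..<m}"
  {
    assume *: "x + p \<in> {0..<n}" "y + q \<in> {0..<m}"
    have y: "y < m - q" "\<not> y + q < m - q" "q \<le> y + q" using * xy m p_less_q by auto
    then show "lifted (x + p) (y + q) = lifted x y + a" "lifted (x + p) y = lifted x (y + q) + a"
      using low'_high'_step[of x y] xy * by (auto simp: lifted_def)
  }
  {
    assume *: "x + q \<in> {0..<n}" "y + p \<in> {0..<m}"
    then show "lifted (x + q) (y + p) = lifted x y + b" "lifted (x + q) y = lifted x (y + p) + b"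
      using run_step[of x y] lifted_eq_run[of y x] lifted_eq_run[of y "x + q"]
        lifted_eq_run[of "y + p" x] lifted_eq_run[of "y + p" "x + q"] xy by auto
  }
qed

end

lemma lift_potential:
  assumes g: "potential e p (b - c * a) a (ivl n) (ivl m) g" and "p < q" "coprime p q" "odd (p + q)"
    and "m \<le> p + q" and n: "n < p + 2 * q - q mod 2"
  shows "\<exists>g'. potential p q a b {0..<n} {0..<m} g'"
proof -
  obtain h where "\<forall>x\<ge>0. (x + p < n \<longrightarrow> h (x + p) = h x + a) \<and>
      (x + 2 * q < n \<longrightarrow> h (x + 2 * q) = h x + 2 * b)"
    using double_step_potential[of p q n a b] assms p_pos by auto
  then show ?thesis using potential_lifted[OF g \<open>p < q\<close> \<open>m \<le> p + q\<close>] by blast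
qed

end

subsection \<open>Descent over the tails\<close>

definition has_potential :: "int \<Rightarrow> int \<Rightarrow> int \<Rightarrow> int \<Rightarrow> bool" where
  "has_potential p q n m \<longleftrightarrow> (\<exists>a b g. a * q \<noteq> b * p \<and> potential p q a b {0..<n} {0..<m} g)"

lemma has_potential_translate:
  assumes "potential p q a b {x0..<x0 + n} {y0..<y0 + m} g" "a * q \<noteq> b * p"
  shows "has_potential p q n m"
  using potential_translate[OF assms(1), of 0 0] assms(2) unfolding has_potential_def by auto

context leaper_step
begin

lemma ivl_eq: "ivl n = {min 0 e..<min 0 e + (n - (q - \<bar>e\<bar>))}"
  by (auto simp: ivl_def q_eq)

lemma has_potential_reduce:
  assumes "0 \<le> q" "has_potential p q n m"
  shows "has_potential \<bar>e\<bar> p (n - (q - \<bar>e\<bar>)) (m - (q - \<bar>e\<bar>))"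
proof -
  obtain a b g where g: "a * q \<noteq> b * p" "potential p q a b {0..<n} {0..<m} g"
    using assms(2) unfolding has_potential_def by blast
  obtain g' where "potential e p (b - c * a) a (ivl n) (ivl m) g'"
    using potential_reduced[OF g(2) assms(1)] by blast
  then have g': "potential e p (b - c * a) a {min 0 e..<min 0 e + (n - (q - \<bar>e\<bar>))}
      {min 0 e..<min 0 e + (m - (q - \<bar>e\<bar>))} g'"
    by (simp only: ivl_eq)
  \<comment> \<open>The reduction only changes the sign of the determinant
    \<open>a * q - b * p\<close>.\<close>
  have det: "(b - c * a) * p \<noteq> a * e" using g(1) by (simp add: q_eq algebra_simps)
  show ?thesis
  proof (cases "0 \<le> e")
    case True
    then show ?thesis using has_potential_translate[OF g' det] by simp
  next
    case False
    have "- (b - c * a) * p \<noteq> a * - e" using det by (metis minus_mult_left mult_minus_right neg_equal_iff_equal)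
    from has_potential_translate[OF potential_neg[OF g'] this] show ?thesis using False by simp
  qed
qed

lemma has_potential_lift:
  assumes "has_potential \<bar>e\<bar> p (n - (q - \<bar>e\<bar>)) (m - (q - \<bar>e\<bar>))"
    and "p < q" "coprime p q" "odd (p + q)" "m \<le> p + q" "n < p + 2 * q - q mod 2"
  shows "has_potential p q n m"
proof -
  obtain a b g where g: "b * p \<noteq> a * \<bar>e\<bar>"
    "potential \<bar>e\<bar> p b a {0..<0 + (n - (q - \<bar>e\<bar>))} {0..<0 + (m - (q - \<bar>e\<bar>))} g"
    using assms(1) unfolding has_potential_def by auto
  define b' where "b' = (if 0 \<le> e then b else - b)"
  obtain g' where "potential \<bar>e\<bar> p b a (ivl n) (ivl m) g'"
    using potential_translate[OF g(2)] unfolding ivl_eq by blast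
  then have "potential e p ((b' + c * a) - c * a) a (ivl n) (ivl m) g'"
    using potential_neg[of "- e" p b a] by (cases "0 \<le> e") (simp_all add: b'_def)
  from lift_potential[OF this] obtain g'' where "potential p q a (b' + c * a) {0..<n} {0..<m} g''"
    using assms by blast
  moreover have "a * q \<noteq> (b' + c * a) * p"
    using g(1) by (cases "0 \<le> e") (auto simp: b'_def q_eq algebra_simps)
  ultimately show ?thesis unfolding has_potential_def by blast
qed

end

text \<open>Comparing reduced fractions turns the real continued fraction into an integer recurrence
  for \<open>P\<close> and \<open>Q\<close>.\<close>

lemma leaper_tailsD:
  assumes t: "leaper_tails p q \<kappa> P Q" and pq: "0 < p" "coprime p q"
  shows "P 0 = 0" "Q 0 = 1" "P \<kappa> = p" "Q \<kappa> = q"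
    and "i \<le> \<kappa> \<Longrightarrow> P i < Q i \<and> coprime (P i) (Q i) \<and> odd (P i + Q i)"
    and "i < \<kappa> \<Longrightarrow> P (Suc i) = Q i \<and>
      (\<exists>c \<delta>. even c \<and> \<delta> \<in> {- 1, 1} \<and> int (Q (Suc i)) = c * int (Q i) + \<delta> * int (P i))"
proof -
  obtain c \<epsilon> where e: "even_cf_expansion \<kappa> c \<epsilon> (real q / real p)"
    and PQ0: "P 0 = 0" "Q 0 = 1"
    and PQ: "\<And>i. i \<in> {1..\<kappa>} \<Longrightarrow> 0 < P i \<and> P i < Q i \<and> coprime (P i) (Q i) \<and>
        real (Q i) / real (P i) = ecf c \<epsilon> i"
    using t unfolding leaper_tails_def by blast
  show "P 0 = 0" "Q 0 = 1" by fact+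
  have ratio: "u = u' \<and> v = v'"
    if "coprime u v" "coprime u' v'" "0 < u" "0 < u'" "real v / real u = real v' / real u'"
    for u v u' v' :: nat
  proof -
    have "real v * real u' = real v' * real u" using that by (simp add: frac_eq_eq)
    then have "v * u' = v' * u" by (metis of_nat_eq_iff of_nat_mult)
    then show ?thesis using that coprime_crossproduct_nat[of v u v' u']
      by (auto simp: coprime_commute mult.commute)
  qed
  have "\<kappa> \<in> {1..\<kappa>}" and cf: "real q / real p = ecf c \<epsilon> \<kappa>"
    using e by (auto simp: even_cf_expansion_def)
  from PQ[OF this(1)] cf show "P \<kappa> = p" "Q \<kappa> = q"
    using ratio[of "P \<kappa>" "Q \<kappa>" p q] pq by auto
  have lt: "P i < Q i" "coprime (P i) (Q i)" if "i \<le> \<kappa>" for i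
    using that PQ0 PQ[of i] by (cases "i = 0"; auto)+
  have step: "P (Suc i) = Q i \<and>
      (\<exists>c \<delta>. even c \<and> \<delta> \<in> {- 1, 1} \<and> int (Q (Suc i)) = c * int (Q i) + \<delta> * int (P i))"
    if i: "i < \<kappa>" for i
  proof (cases i)
    case 0
    have S: "0 < P 1" "coprime (P 1) (Q 1)" "real (Q 1) / real (P 1) = ecf c \<epsilon> 1"
      using PQ[of 1] i by auto
    then have "P 1 = 1 \<and> Q 1 = c 1" using ratio[of "P 1" "Q 1" 1 "c 1"] by simp
    moreover have "even (c 1)" using e i by (auto simp: even_cf_expansion_def)
    ultimately show ?thesis using PQ0 0 by (auto intro!: exI[of _ "int (c 1)"] exI[of _ 1])
  next
    case (Suc j)
    define z where "z = int (c (Suc i)) * int (Q i) + \<epsilon> i * int (P i)"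
    have S: "0 < P (Suc i)" "coprime (P (Suc i)) (Q (Suc i))"
      "real (Q (Suc i)) / real (P (Suc i)) = ecf c \<epsilon> (Suc i)"
      using PQ[of "Suc i"] i by auto
    have I: "0 < P i" "P i < Q i" "coprime (P i) (Q i)" "real (Q i) / real (P i) = ecf c \<epsilon> i"
      using PQ[of i] i Suc by auto
    have ce: "even (c (Suc i))" "0 < c (Suc i)" "\<epsilon> i \<in> {- 1, 1}"
      using e i Suc by (auto simp: even_cf_expansion_def)
    have "1 * int (Q i) \<le> int (c (Suc i)) * int (Q i)" using ce by (intro mult_right_mono) auto
    moreover have "\<bar>\<epsilon> i * int (P i)\<bar> = int (P i)" using ce(3) by auto
    ultimately have z: "0 < z" unfolding z_def using I(2) by linarith
    have "ecf c \<epsilon> (Suc i) = real (c (Suc i)) + real_of_int (\<epsilon> i) / ecf c \<epsilon> i"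
      using Suc by simp
    also have "\<dots> = real_of_int z / real (Q i)"
      using I(1,2) unfolding I(4)[symmetric] z_def by (simp add: field_simps)
    finally have "real (Q (Suc i)) / real (P (Suc i)) = real (nat z) / real (Q i)"
      using S(3) z by simp
    moreover have "coprime (int (Q i)) z"
    proof -
      have "coprime (int (Q i)) (\<epsilon> i * int (P i))" using I(3) ce(3) by (auto simp: coprime_commute)
      then show ?thesis unfolding z_def coprime_iff_gcd_eq_1 by (metis gcd_add_mult)
    qed
    then have "coprime (Q i) (nat z)" using z by (metis coprime_int_iff int_nat_eq less_imp_le)
    ultimately have "P (Suc i) = Q i \<and> Q (Suc i) = nat z"
      using ratio[of "P (Suc i)" "Q (Suc i)" "Q i" "nat z"] S I by simp
    then have PQ': "P (Suc i) = Q i" "int (Q (Suc i)) = z" using z by simp_all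
    show ?thesis
      using ce PQ' unfolding z_def
      by (intro conjI exI[of _ "int (c (Suc i))"] exI[of _ "\<epsilon> i"]) simp_all
  qed
  then show "i < \<kappa> \<Longrightarrow> P (Suc i) = Q i \<and>
      (\<exists>c \<delta>. even c \<and> \<delta> \<in> {- 1, 1} \<and> int (Q (Suc i)) = c * int (Q i) + \<delta> * int (P i))" .
  have "odd (P i + Q i)" if "i \<le> \<kappa>" for i
    using that
  proof (induction i)
    case (Suc i)
    then obtain c' \<delta> where s: "P (Suc i) = Q i" "even c'" "\<delta> \<in> {- 1, 1}"
        "int (Q (Suc i)) = c' * int (Q i) + \<delta> * int (P i)"
      using step[of i] by auto
    have "even (int (Q (Suc i))) \<longleftrightarrow> even (int (P i))" unfolding s(4) using s(2,3) by auto
    then show ?case using Suc s(1) by simp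
  qed (simp add: PQ0)
  then show "i \<le> \<kappa> \<Longrightarrow> P i < Q i \<and> coprime (P i) (Q i) \<and> odd (P i + Q i)"
    using lt by blast
qed

lemma leaper_step_tails:
  assumes "leaper_tails p q \<kappa> P Q" "0 < p" "coprime p q" "i < \<kappa>"
  obtains c e where "leaper_step (int (P (Suc i))) (int (Q (Suc i))) c e" "\<bar>e\<bar> = int (P i)"
    "P (Suc i) = Q i"
proof -
  note T = leaper_tailsD[OF assms(1-3)]
  obtain c \<delta> where *: "P (Suc i) = Q i" "even c" "\<delta> \<in> {- 1, 1}"
    "int (Q (Suc i)) = c * int (Q i) + \<delta> * int (P i)"
    using T(6)[OF assms(4)] by blast
  have lt: "P i < Q i" using T(5)[of i] assms(4) by simp
  show ?thesis
  proof (rule that[of c "\<delta> * int (P i)"])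
    show "leaper_step (int (P (Suc i))) (int (Q (Suc i))) c (\<delta> * int (P i))"
      by unfold_locales (use * lt in auto)
  qed (use * in auto)
qed

text \<open>One reduction shortens both sides by \<open>Q (Suc k) - P k\<close>. As
  \<open>P (Suc k) = Q k\<close>, this takes both bounds for \<open>Suc k\<close> to those for
  \<open>k\<close>, down to \<open>potential_rigid_last\<close> at \<open>k = i\<close>.\<close>

lemma not_has_potential:
  assumes t: "leaper_tails p q \<kappa> P Q" "0 < p" "coprime p q"
    and "i \<le> k" "k \<le> \<kappa>"
    and "int (P k) + int (Q k) - int (P i) + 1 \<le> m"
    and "int (P k) + int (Q k) + int (Q i) - int (Q i) mod 2 \<le> n"
  shows "\<not> has_potential (int (P k)) (int (Q k)) n m"
  using assms(4-)
proof (induction k arbitrary: n m rule: dec_induct)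
  case base
  have pq: "P i < Q i" "odd (P i + Q i)" using leaper_tailsD(5)[OF t, of i] base by auto
  show ?case
  proof
    assume "has_potential (int (P i)) (int (Q i)) n m"
    then obtain a b g where "a * int (Q i) \<noteq> b * int (P i)"
        "potential (int (P i)) (int (Q i)) a b {0..<n} {0..<m} g"
      unfolding has_potential_def by blast
    moreover have "odd (int (P i) + int (Q i))" using pq(2) by simp
    ultimately show False
      using potential_rigid_last[of "int (P i)" "int (Q i)" a b n m g] pq(1) base by simp
  qed
next
  case (step k)
  obtain c e where ls: "leaper_step (int (P (Suc k))) (int (Q (Suc k))) c e"
    and e: "\<bar>e\<bar> = int (P k)" and PQ: "P (Suc k) = Q k"
    using leaper_step_tails[OF t, of k] step.prems by auto
  interpret leaper_step "int (P (Suc k))" "int (Q (Suc k))" c e by (rule ls)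
  show ?case
    using has_potential_reduce[of n m] step.IH[of "m - (int (Q (Suc k)) - int (P k))" "n - (int (Q (Suc k)) - int (P k))"]
      step.prems PQ e by auto
qed

text \<open>In the step to \<open>Suc k\<close>, the indices \<open>0\<close> and
  \<open>Suc k\<close> leave three cases: few columns, where a function of \<open>x\<close> alone
  serves; at most \<open>q'\<close> rows, where no \<open>p'\<close>-step in \<open>x\<close>
  exists; or a board on which the reduction can be inverted.\<close>

lemma has_potentialI:
  assumes t: "leaper_tails p q \<kappa> P Q" "0 < p" "coprime p q"
    and "k \<le> \<kappa>"
    and "\<And>i. i \<le> k \<Longrightarrow> \<not> (int (P k) + int (Q k) - int (P i) + 1 \<le> m \<and>
        int (P k) + int (Q k) + int (Q i) - int (Q i) mod 2 \<le> n)"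
  shows "has_potential (int (P k)) (int (Q k)) n m"
  using assms(4-)
proof (induction k arbitrary: n m)
  case 0
  have "n \<le> 0 \<or> m \<le> 1" using 0(2)[of 0] leaper_tailsD(1,2)[OF t] by auto
  then have "potential 0 1 1 0 {0..<n} {0..<m} (\<lambda>_ _. 0)" by (auto simp: potential_def)
  then have "has_potential 0 1 n m"
    unfolding has_potential_def by (intro exI[of _ 1] exI[of _ 0] exI conjI) simp_all
  then show ?case by (simp add: leaper_tailsD(1,2)[OF t])
next
  case (Suc k)
  obtain c e where ls: "leaper_step (int (P (Suc k))) (int (Q (Suc k))) c e"
    and e: "\<bar>e\<bar> = int (P k)" and PQ: "P (Suc k) = Q k"
    using leaper_step_tails[OF t, of k] Suc.prems by auto
  interpret leaper_step "int (P (Suc k))" "int (Q (Suc k))" c e by (rule ls)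
  define p' q' where "p' = int (P (Suc k))" and "q' = int (Q (Suc k))"
  have "P (Suc k) < Q (Suc k) \<and> coprime (P (Suc k)) (Q (Suc k)) \<and> odd (P (Suc k) + Q (Suc k))"
    using leaper_tailsD(5)[OF t] Suc.prems by blast
  then have pq: "p' < q'" "coprime p' q'" "odd (p' + q')" by (auto simp: p'_def q'_def)
  have "0 < p'" using p_pos by (simp add: p'_def)
  have det: "(1::int) * q' \<noteq> 0 * p'" using pq \<open>0 < p'\<close> by simp
  have "n < p' + q' \<or> m \<le> p' + q'"
    using Suc.prems(2)[of 0] leaper_tailsD(1,2)[OF t] by (auto simp: p'_def q'_def)
  moreover have "m \<le> q' \<or> n < p' + 2 * q' - q' mod 2"
    using Suc.prems(2)[of "Suc k"] by (auto simp: p'_def q'_def)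
  ultimately consider "n < p' + q'" | "m \<le> q'" | "m \<le> p' + q'" "n < p' + 2 * q' - q' mod 2"
    by blast
  then have "has_potential p' q' n m"
  proof cases
    case 1
    obtain h :: "int \<Rightarrow> int" where "\<forall>x\<ge>0. (x + p' < p' + q' - 1 \<longrightarrow> h (x + p') = h x + 1) \<and>
        (x + q' < p' + q' - 1 \<longrightarrow> h (x + q') = h x + 0)"
      using two_step_potential[of p' q' 1 0] pq(1,2) \<open>0 < p'\<close> by (meson less_trans)
    then have "potential p' q' 1 0 {0..<n} {0..<m} (\<lambda>x _. h x)" using 1 by (auto simp: potential_def)
    then show ?thesis using det unfolding has_potential_def by blast
  next
    case 2
    then have "potential p' q' 1 0 {0..<n} {0..<m} (\<lambda>_ _. 0)" by (auto simp: potential_def)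
    then show ?thesis using det unfolding has_potential_def by blast
  next
    case 3
    have "has_potential \<bar>e\<bar> p' (n - (q' - \<bar>e\<bar>)) (m - (q' - \<bar>e\<bar>))"
      unfolding p'_def PQ e
    proof (rule Suc.IH)
      show "k \<le> \<kappa>" using Suc.prems by simp
      fix i assume "i \<le> k"
      then have "i \<le> Suc k" by simp
      from Suc.prems(2)[OF this]
      show "\<not> (int (P k) + int (Q k) - int (P i) + 1 \<le> m - (q' - int (P k)) \<and>
          int (P k) + int (Q k) + int (Q i) - int (Q i) mod 2 \<le> n - (q' - int (P k)))"
        unfolding q'_def PQ by linarith
    qed
    then show ?thesis using has_potential_lift[of n m] pq 3 by (simp add: p'_def q'_def)
  qed
  then show ?case by (simp add: p'_def q'_def)
qed

subsection \<open>Flexibility and potentials\<close>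

lemma board_of_size_unique:
  assumes "board_of_size m n A" "board_of_size m' n' A"
  shows "m = m'" "n = n'"
proof -
  obtain x y x' y' where A: "A = {x..<x + int n} \<times> {y..<y + int m}"
      "A = {x'..<x' + int n'} \<times> {y'..<y' + int m'}"
    and pos: "1 \<le> m" "1 \<le> n" "1 \<le> m'" "1 \<le> n'"
    using assms unfolding board_of_size_def by blast
  have "card (fst ` A) = n \<and> card (snd ` A) = m"
    unfolding A(1) using pos by simp
  moreover have "card (fst ` A) = n' \<and> card (snd ` A) = m'"
    unfolding A(2) using pos by simp
  ultimately show "m = m'" "n = n'" by simp_all
qed

lemma board_le_iff:
  assumes "board_of_size m' n' A'" "board_of_size m'' n'' A''"
  shows "A' \<sqsubseteq> A'' \<longleftrightarrow> m' \<le> m'' \<and> n' \<le> n'' \<or> n' \<le> m'' \<and> m' \<le> n''"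
  using assms board_of_size_unique unfolding board_le_def by metis

section \<open>Moves, directions and the coordinates of an isomorphism\<close>

lemma move_direction_adjacent:
  assumes "move_direction L a b d"
  shows "adjacent L a b"
proof -
  obtain r s x y x' y' where e: "L = (r, s)" "a = (x, y)" "b = (x', y')"
    by (cases L; cases a; cases b)
  define lo hi where "lo = int (min r s)" and "hi = int (max r s)"
  have "(x' - x, y' - y) = direction_offset lo hi d" "0 \<le> lo" "0 \<le> hi"
    using assms by (simp_all add: e lo_def hi_def)
  then have "\<bar>x - x'\<bar> = lo \<and> \<bar>y - y'\<bar> = hi \<or> \<bar>x - x'\<bar> = hi \<and> \<bar>y - y'\<bar> = lo"
    by (cases d) auto
  then have "{\<bar>x - x'\<bar>, \<bar>y - y'\<bar>} = {lo, hi}" by (elim disjE conjE) (simp_all add: insert_commute)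
  also have "{lo, hi} = {int r, int s}"
    by (cases "r \<le> s") (simp_all add: lo_def hi_def insert_commute)
  finally show ?thesis by (simp add: e)
qed

lemma adjacent_move_direction:
  assumes "adjacent (r, s) (x, y) (x', y')" "r < s"
  obtains d where "move_direction (r, s) (x, y) (x', y') d"
proof -
  have sign: "\<bar>z - z'\<bar> = int t \<longleftrightarrow> z' - z = int t \<or> z' - z = - int t" for z z' t
    by auto
  have "\<bar>x - x'\<bar> = int r \<and> \<bar>y - y'\<bar> = int s \<or> \<bar>x - x'\<bar> = int s \<and> \<bar>y - y'\<bar> = int r"
    using assms(1) by (auto simp: doubleton_eq_iff)
  then consider "x' - x = int s" "y' - y = int r" | "x' - x = int r" "y' - y = int s"
    | "x' - x = - int r" "y' - y = int s" | "x' - x = - int s" "y' - y = int r"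
    | "x' - x = - int s" "y' - y = - int r" | "x' - x = - int r" "y' - y = - int s"
    | "x' - x = int r" "y' - y = - int s" | "x' - x = int s" "y' - y = - int r"
    unfolding sign by blast
  then show ?thesis
  proof cases
    case 1 then show ?thesis using assms(2) by (intro that[of ENE]) simp
  next
    case 2 then show ?thesis using assms(2) by (intro that[of NNE]) simp
  next
    case 3 then show ?thesis using assms(2) by (intro that[of NNW]) simp
  next
    case 4 then show ?thesis using assms(2) by (intro that[of WNW]) simp
  next
    case 5 then show ?thesis using assms(2) by (intro that[of WSW]) simp
  next
    case 6 then show ?thesis using assms(2) by (intro that[of SSW]) simp
  next
    case 7 then show ?thesis using assms(2) by (intro that[of SSE]) simp
  next
    case 8 then show ?thesis using assms(2) by (intro that[of ESE]) simp
  qed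
qed

lemma flexible_imp_has_potential:
  fixes n m :: int
  assumes p: "0 < p" "p < q" and A: "A = {x0..<x0 + n} \<times> {y0..<y0 + m}"
    and flex: "directionally_flexible (p, q) (complete_leaper_graph (p, q) A)"
  shows "has_potential (int p) (int q) n m" "has_potential (int p) (int q) m n"
proof -
  obtain L G where sk': "skew L" "\<not> proportional L (p, q)"
    and iso: "direction_isomorphic (p, q) (complete_leaper_graph (p, q) A) L G"
    using flex unfolding directionally_flexible_def by blast
  obtain r0 s0 where L: "L = (r0, s0)" by (cases L)
  note sk = sk'[unfolded L]
  obtain \<phi> where \<phi>: "\<And>a b. {a, b} \<in> snd (complete_leaper_graph (p, q) A) \<Longrightarrow>
        \<exists>d. move_direction (p, q) a b d \<and> move_direction (r0, s0) (\<phi> a) (\<phi> b) d"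
    using iso unfolding direction_isomorphic_def L by blast
  define r s where "r = int (min r0 s0)" and "s = int (max r0 s0)"
  have det: "r * int q \<noteq> s * int p"
  proof
    assume "r * int q = s * int p"
    then have "int (min r0 s0 * q) = int (max r0 s0 * p)" unfolding r_def s_def by simp
    then have "min r0 s0 * q = max r0 s0 * p" by (simp only: of_nat_eq_iff)
    then have "real (min r0 s0) * real q = real (max r0 s0) * real p" by (metis of_nat_mult)
    then have "real (min r0 s0) / real (max r0 s0) = real p / real q"
      using sk(1) p by (simp add: frac_eq_eq mult.commute)
    then show False using sk(2) p by simp
  qed
  have off: "(fst (\<phi> b) - fst (\<phi> a), snd (\<phi> b) - snd (\<phi> a)) = direction_offset r s d"
    if "a \<in> A" "b \<in> A" "move_direction (p, q) a b d" for a b d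
  proof -
    have "{a, b} \<in> snd (complete_leaper_graph (p, q) A)"
      using that(1,2) move_direction_adjacent[OF that(3)]
      unfolding complete_leaper_graph_def snd_conv by blast
    from \<phi>[OF this] obtain d' where d': "move_direction (p, q) a b d'"
      "move_direction (r0, s0) (\<phi> a) (\<phi> b) d'" by blast
    \<comment> \<open>As \<open>0 < p < q\<close>, a move has only one direction.\<close>
    have "d' = d" using that(3) d'(1) p by (cases d; cases d') auto
    then show ?thesis using d'(2) by (simp add: r_def s_def)
  qed
  have mem: "(x, y) \<in> A \<longleftrightarrow> x \<in> {x0..<x0 + n} \<and> y \<in> {y0..<y0 + m}" for x y using A by auto
  have E: "fst (\<phi> (x + int p, y + int q)) = fst (\<phi> (x, y)) + r"
      "snd (\<phi> (x + int p, y + int q)) = snd (\<phi> (x, y)) + s"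
    if "(x, y) \<in> A" "(x + int p, y + int q) \<in> A" for x y
    using off[OF that, of NNE] p by simp_all
  have E': "fst (\<phi> (x + int q, y + int p)) = fst (\<phi> (x, y)) + s"
      "snd (\<phi> (x + int q, y + int p)) = snd (\<phi> (x, y)) + r"
    if "(x, y) \<in> A" "(x + int q, y + int p) \<in> A" for x y
    using off[OF that, of ENE] p by simp_all
  have F: "fst (\<phi> (x + int p, y)) = fst (\<phi> (x, y + int q)) + r"
      "snd (\<phi> (x, y + int q)) = snd (\<phi> (x + int p, y)) + s"
    if "(x, y + int q) \<in> A" "(x + int p, y) \<in> A" for x y
    using off[OF that, of SSE] p by simp_all
  have F': "fst (\<phi> (x + int q, y)) = fst (\<phi> (x, y + int p)) + s"
      "snd (\<phi> (x, y + int p)) = snd (\<phi> (x + int q, y)) + r"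
    if "(x, y + int p) \<in> A" "(x + int q, y) \<in> A" for x y
    using off[OF that, of ESE] p by simp_all
  have "potential (int p) (int q) r s {x0..<x0 + n} {y0..<y0 + m} (\<lambda>x y. fst (\<phi> (x, y)))"
    by (rule potentialI) (simp_all only: E E' F F' mem simp_thms)
  then show "has_potential (int p) (int q) n m" using has_potential_translate det by blast
  have "potential (int p) (int q) r s {y0..<y0 + m} {x0..<x0 + n} (\<lambda>y x. snd (\<phi> (x, y)))"
    by (rule potentialI) (simp_all only: E E' F F' mem simp_thms)
  then show "has_potential (int p) (int q) m n" using has_potential_translate det by blast
qed

text \<open>Subtracting \<open>b * x\<close> from \<open>q * g\<close> cancels the increment over
  \<open>q\<close>-steps; the factor \<open>k\<close> serves to give two potentials the same
  increment over \<open>p\<close>-steps.\<close>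

lemma potential_normalize:
  assumes "potential p q a b X Y g"
  shows "potential p q (k * (a * q - b * p)) 0 X Y (\<lambda>x y. k * (q * g x y - b * x))"
  by (rule potentialI) (simp_all add: potentialD[OF assms] potentialD'[OF assms] algebra_simps)

text \<open>Normalise both potentials to increments \<open>(D, 0)\<close> and add them to \<open>N\<close> times the identity. For
  large \<open>N\<close> the result is injective.\<close>

lemma has_potential_imp_flexible:
  fixes n m :: int
  assumes p: "0 < p" "p < q" and A: "A = {x0..<x0 + n} \<times> {y0..<y0 + m}"
    and h: "has_potential (int p) (int q) n m" "has_potential (int p) (int q) m n"
  shows "directionally_flexible (p, q) (complete_leaper_graph (p, q) A)"
proof -
  obtain a1 b1 g1 where 1: "a1 * int q \<noteq> b1 * int p"
    "potential (int p) (int q) a1 b1 {0..<n} {0..<m} g1"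
    using h(1) unfolding has_potential_def by blast
  obtain a2 b2 g2 where 2: "a2 * int q \<noteq> b2 * int p"
    "potential (int p) (int q) a2 b2 {0..<m} {0..<n} g2"
    using h(2) unfolding has_potential_def by blast
  define D where "D = (a2 * int q - b2 * int p) * (a1 * int q - b1 * int p)"
  have "D \<noteq> 0" using 1(1) 2(1) by (simp add: D_def)
  define X Y where "X = {x0..<x0 + n}" and "Y = {y0..<y0 + m}"
  obtain u where u: "potential (int p) (int q) D 0 X Y u"
    using potential_normalize[OF potential_translate[of "int p" "int q" a1 b1 0 n 0 m g1 x0 y0], of "a2 * int q - b2 * int p"]
      1(2) by (auto simp: D_def X_def Y_def)
  obtain v where v: "potential (int p) (int q) D 0 Y X v"
    using potential_normalize[OF potential_translate[of "int p" "int q" a2 b2 0 m 0 n g2 y0 x0], of "a1 * int q - b1 * int p"]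
      2(2) by (auto simp: D_def X_def Y_def mult.commute)
  have AXY: "A = X \<times> Y" and fin: "finite A" using A by (auto simp: X_def Y_def)
  define M where "M = (\<Sum>c\<in>A. \<bar>u (fst c) (snd c)\<bar> + \<bar>v (snd c) (fst c)\<bar>)"
  have M: "\<bar>u x y\<bar> + \<bar>v y x\<bar> \<le> M" if "(x, y) \<in> A" for x y
    using member_le_sum[of "(x, y)" A "\<lambda>c. \<bar>u (fst c) (snd c)\<bar> + \<bar>v (snd c) (fst c)\<bar>"] that fin
    by (simp add: M_def)
  \<comment> \<open>\<open>2 * M < N\<close> yields injectivity, and
    \<open>\<bar>D\<bar> < N\<close> yields \<open>0 < r < s\<close>.\<close>
  define N where "N = 2 * M + \<bar>D\<bar> + 1"
  have M0: "0 \<le> M" unfolding M_def by (intro sum_nonneg) simp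
  have N: "2 * M < N" "\<bar>D\<bar> < N" using M0 by (simp_all add: N_def)
  define \<phi> where "\<phi> = (\<lambda>c. (N * fst c + u (fst c) (snd c), N * snd c + v (snd c) (fst c)))"
  have small: "z = 0" if "N * z = w" "\<bar>w\<bar> \<le> 2 * M" for z w
  proof (rule ccontr)
    assume "z \<noteq> 0"
    then have "N * 1 \<le> N * \<bar>z\<bar>" using N M0 by (intro mult_left_mono) auto
    also have "\<dots> = \<bar>w\<bar>" using N M0 by (simp add: that(1)[symmetric] abs_mult)
    finally show False using that(2) N by simp
  qed
  have inj: "inj_on \<phi> A"
  proof (rule inj_onI)
    fix c d assume cd: "c \<in> A" "d \<in> A" "\<phi> c = \<phi> d"
    obtain x y x' y' where xy: "c = (x, y)" "d = (x', y')" by (cases c; cases d) auto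
    have eq: "N * (x - x') = u x' y' - u x y" "N * (y - y') = v y' x' - v y x"
      using cd(3) by (simp_all add: \<phi>_def xy algebra_simps)
    have "\<bar>u x y\<bar> + \<bar>v y x\<bar> \<le> M" "\<bar>u x' y'\<bar> + \<bar>v y' x'\<bar> \<le> M"
      using M cd(1,2) by (simp_all add: xy)
    then have "\<bar>u x' y' - u x y\<bar> \<le> 2 * M" "\<bar>v y' x' - v y x\<bar> \<le> 2 * M" by linarith+
    then have "x - x' = 0 \<and> y - y' = 0" using small[OF eq(1)] small[OF eq(2)] by simp
    then show "c = d" by (simp add: xy)
  qed
  define r s where "r = N * int p + D" and "s = N * int q"
  have "N * 1 \<le> N * int p" "N * 1 \<le> N * (int q - int p)"
    using p M0 by (intro mult_left_mono; simp add: N_def)+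
  then have rs: "0 < r" "r < s" using N unfolding r_def s_def right_diff_distrib by linarith+
  define L where "L = (nat r, nat s)"
  have skew: "skew L" using rs by (simp add: L_def)
  have nonprop: "\<not> proportional L (p, q)"
  proof
    assume "proportional L (p, q)"
    then have "real_of_int r / real_of_int s = real p / real q"
      using rs p by (simp add: L_def)
    then have "real_of_int r * real q = real p * real_of_int s"
      using rs p by (simp add: frac_eq_eq)
    then have "real_of_int (r * int q) = real_of_int (int p * s)" by simp
    then have "r * int q = int p * s" by (simp only: of_int_eq_iff)
    then have "D * int q = 0" by (simp add: r_def s_def algebra_simps)
    then show False using \<open>D \<noteq> 0\<close> p by simp
  qed
  have dir: "move_direction L (\<phi> a) (\<phi> b) d"
    if ab: "a \<in> A" "b \<in> A" "move_direction (p, q) a b d" for a b d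
  proof -
    obtain x y x' y' where xy: "a = (x, y)" "b = (x', y')" by (cases a; cases b) auto
    have mem: "x \<in> X" "y \<in> Y" "x' \<in> X" "y' \<in> Y" using ab AXY by (auto simp: xy)
    have L: "move_direction L (\<phi> a) (\<phi> b) d \<longleftrightarrow>
      (N * (x' - x) + (u x' y' - u x y), N * (y' - y) + (v y' x' - v y x)) = direction_offset r s d"
      using rs by (simp add: L_def \<phi>_def xy algebra_simps)
    note U = potentialD[OF u mem(1,2)] and U' = potentialD[OF u mem(3,4)]
      and V = potentialD[OF v mem(2,1)] and V' = potentialD[OF v mem(4,3)]
    have m: "(x' - x, y' - y) = direction_offset (int p) (int q) d"
      using ab(3) p by (simp add: xy)
    show ?thesis
    proof (cases d)
      case ENE
      then have e: "x' = x + int q" "y' = y + int p" using m by auto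
      then show ?thesis unfolding L using ENE U(3) V(1) mem by (simp add: r_def s_def)
    next
      case NNE
      then have e: "x' = x + int p" "y' = y + int q" using m by auto
      then show ?thesis unfolding L using NNE U(1) V(3) mem by (simp add: r_def s_def)
    next
      case NNW
      then have e: "x = x' + int p" "y = y' - int q" "y' = y + int q" using m by auto
      then show ?thesis unfolding L using NNW U'(2) V(4) mem by (simp add: r_def s_def)
    next
      case WNW
      then have e: "x = x' + int q" "y = y' - int p" "y' = y + int p" using m by auto
      then show ?thesis unfolding L using WNW U'(4) V(2) mem by (simp add: r_def s_def)
    next
      case WSW
      then have e: "x = x' + int q" "y = y' + int p" using m by auto
      then show ?thesis unfolding L using WSW U'(3) V'(1) mem by (simp add: r_def s_def)
    next
      case SSW
      then have e: "x = x' + int p" "y = y' + int q" using m by auto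
      then show ?thesis unfolding L using SSW U'(1) V'(3) mem by (simp add: r_def s_def)
    next
      case SSE
      then have e: "x' = x + int p" "y' = y - int q" "y = y' + int q" using m by auto
      then show ?thesis unfolding L using SSE U(2) V'(4) mem by (simp add: r_def s_def)
    next
      case ESE
      then have e: "x' = x + int q" "y' = y - int p" "y = y' + int p" using m by auto
      then show ?thesis unfolding L using ESE U(4) V'(2) mem by (simp add: r_def s_def)
    qed
  qed
  define E where "E = snd (complete_leaper_graph (p, q) A)"
  have G: "complete_leaper_graph (p, q) A = (A, E)"
    by (simp add: E_def complete_leaper_graph_def)
  have E_iff: "e \<in> E \<longleftrightarrow> (\<exists>a b. e = {a, b} \<and> a \<in> A \<and> b \<in> A \<and> adjacent (p, q) a b)" for e
    by (simp only: E_def complete_leaper_graph_def snd_conv mem_Collect_eq)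
  have EA: "e \<subseteq> A" if "e \<in> E" for e
    using that E_iff by auto
  have Edir: "\<exists>d. move_direction (p, q) a b d" "a \<in> A" "b \<in> A" if "{a, b} \<in> E" for a b
  proof -
    show ab: "a \<in> A" "b \<in> A" using EA[OF that] by auto
    from E_iff[THEN iffD1, OF that]
    obtain a' b' where e: "{a, b} = {a', b'}" "adjacent (p, q) a' b'" by iprover
    have sym: "adjacent (p, q) b' a'"
      using e(2) by (cases a'; cases b') (simp add: abs_minus_commute)
    have "a = a' \<and> b = b' \<or> a = b' \<and> b = a'" using e(1) by (simp only: doubleton_eq_iff)
    then have "adjacent (p, q) a b" using e(2) sym by (elim disjE conjE) simp_all
    then show "\<exists>d. move_direction (p, q) a b d"
      using adjacent_move_direction[OF _ p(2)] by (cases a; cases b) metis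
  qed
  have "leaper_graph (p, q) (A, E)"
    by (auto simp: E_def complete_leaper_graph_def)
  moreover have "leaper_graph L (\<phi> ` A, (`) \<phi> ` E)"
  proof -
    have "\<exists>a b. \<phi> ` e = {a, b} \<and> a \<in> \<phi> ` A \<and> b \<in> \<phi> ` A \<and> adjacent L a b" if "e \<in> E" for e
    proof -
      from E_iff[THEN iffD1, OF that] obtain a b where e: "e = {a, b}" by iprover
      from Edir[OF that[unfolded e]] dir obtain d where "move_direction L (\<phi> a) (\<phi> b) d" by blast
      then have "adjacent L (\<phi> a) (\<phi> b)" by (rule move_direction_adjacent)
      then show ?thesis using Edir[OF that[unfolded e]]
        by (intro exI[of _ "\<phi> a"] exI[of _ "\<phi> b"]) (simp add: e)
    qed
    then show ?thesis by (cases L) auto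
  qed
  moreover have "direction_isomorphic (p, q) (A, E) L (\<phi> ` A, (`) \<phi> ` E)"
    unfolding direction_isomorphic_def
  proof (intro exI[of _ \<phi>] conjI allI impI)
    have "{a, b} \<in> E \<longleftrightarrow> {\<phi> a, \<phi> b} \<in> (`) \<phi> ` E" if "a \<in> A" "b \<in> A" for a b
    proof
      assume "{\<phi> a, \<phi> b} \<in> (`) \<phi> ` E"
      then obtain e where e: "e \<in> E" "\<phi> ` e = \<phi> ` {a, b}" by auto
      then have "e = {a, b}" using inj_on_image_eq_iff[OF inj EA[OF e(1)], of "{a, b}"] that by simp
      then show "{a, b} \<in> E" using e by simp
    next
      assume "{a, b} \<in> E"
      then show "{\<phi> a, \<phi> b} \<in> (`) \<phi> ` E" by (metis image_empty image_eqI image_insert)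
    qed
    then show "graph_iso \<phi> (A, E) (\<phi> ` A, (`) \<phi> ` E)"
      using inj by (simp add: bij_betw_def)
    show "\<exists>d. move_direction (p, q) a b d \<and> move_direction L (\<phi> a) (\<phi> b) d"
      if "{a, b} \<in> snd (A, E)" for a b
      using Edir[OF that[unfolded snd_conv]] dir by blast
  qed
  ultimately show ?thesis
    unfolding directionally_flexible_def G fst_conv using fin skew nonprop by blast
qed

section \<open>Rigidity as the absence of a pair of potentials\<close>

lemma rigid_iff:
  assumes p: "0 < p" "p < q" and A: "board_of_size m n A"
  shows "directionally_rigid (p, q) (complete_leaper_graph (p, q) A) \<longleftrightarrow>
    \<not> (has_potential (int p) (int q) (int n) (int m) \<and> has_potential (int p) (int q) (int m) (int n))"
proof -
  obtain x0 y0 where xy: "A = {x0..<x0 + int n} \<times> {y0..<y0 + int m}"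
    using A unfolding board_of_size_def by blast
  have "leaper_graph (p, q) (complete_leaper_graph (p, q) A)"
    by (auto simp: complete_leaper_graph_def)
  moreover have "finite (fst (complete_leaper_graph (p, q) A))"
    by (simp add: complete_leaper_graph_def xy)
  ultimately show ?thesis
    using flexible_imp_has_potential[OF p xy] has_potential_imp_flexible[OF p xy]
    unfolding directionally_rigid_def by blast
qed

theorem theorem1:
  fixes p q \<kappa> :: nat
    and P Q :: "nat \<Rightarrow> nat"
    and A_R :: "nat \<Rightarrow> cell set"
    and A :: "cell set"
  assumes "0 < p" and "p < q" and "odd (p + q)" and "gcd p q = 1"
    and "leaper_tails p q \<kappa> P Q"
    and "\<And>i. i \<le> \<kappa> \<Longrightarrow> board_of_size (p + q - P i + 1) (p + q + Q i - Q i mod 2) (A_R i)"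
    and "board A"
  shows "directionally_rigid (p, q) (complete_leaper_graph (p, q) A) \<longleftrightarrow>
         (\<exists>i\<le>\<kappa>. A_R i \<sqsubseteq> A)"
proof -
  obtain m n where A: "board_of_size m n A" using \<open>board A\<close> unfolding board_def by blast
  have cop: "coprime p q" using assms(4) by (simp add: coprime_iff_gcd_eq_1)
  note t = assms(5,1) cop
  note PQ = leaper_tailsD(3,4)[OF t]
  define fits where "fits m n i \<longleftrightarrow> p + q - P i + 1 \<le> m \<and> p + q + Q i - Q i mod 2 \<le> n" for m n i
  have le: "A_R i \<sqsubseteq> A \<longleftrightarrow> fits m n i \<or> fits n m i" if "i \<le> \<kappa>" for i
    unfolding board_le_iff[OF assms(6)[OF that] A] fits_def by blast
  \<comment> \<open>This ensures that the natural subtraction \<open>p + q - P i\<close> is not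
    truncated.\<close>
  have P_le: "P i \<le> P \<kappa>" if "i \<le> \<kappa>" for i
    using that
  proof (induction i rule: inc_induct)
    case (step k)
    then show ?case using leaper_tailsD(5)[OF t, of k] leaper_tailsD(6)[OF t, of k] by simp
  qed simp
  have fits: "fits m n i \<longleftrightarrow> int (P \<kappa>) + int (Q \<kappa>) - int (P i) + 1 \<le> int m \<and>
      int (P \<kappa>) + int (Q \<kappa>) + int (Q i) - int (Q i) mod 2 \<le> int n" if "i \<le> \<kappa>" for m n i
  proof -
    have "int (Q i) mod 2 = int (Q i mod 2)" by (simp add: zmod_int)
    moreover have "Q i mod 2 \<le> Q i" by simp
    ultimately show ?thesis using P_le[OF that] unfolding fits_def PQ by linarith
  qed
  have "has_potential (int p) (int q) (int n) (int m) \<longleftrightarrow> (\<forall>i\<le>\<kappa>. \<not> fits m n i)" for m n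
    using not_has_potential[OF t _ order_refl, of _ "int m" "int n"]
      has_potentialI[OF t order_refl, of "int m" "int n"] fits unfolding PQ by blast
  then show ?thesis
    using rigid_iff[OF assms(1,2) A] le by blast
qed

end
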